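(* Let $N\ge 2$ and consider an $N$-player game with cost functions $f_i:\mathbb{R}^N\to\mathbb{R}$, $i\in\mathcal{N}=\{1,\dots,N\}$, where the action $x_i\in\mathbb{R}$ of player $i$ is governed by $$\dot x_i=b_iu_i+\phi_i(x_i)\theta_i,\quad i\in\mathcal{N},$$ with $b_i\ne0$ an unknown constant, $\theta_i\in\mathbb{R}$ an unknown constant parameter and $\phi_i$ a known sufficiently smooth function. Suppose: (A1) each $f_i$ is sufficiently smooth and $\frac{\partial f_i}{\partial x_i}$ is globally Lipschitz with constant $l_i$; (A2) there is a constant $m>0$ with $(\mathbf{x}-\mathbf{z})^T(\mathcal{P}(\mathbf{x})-\mathcal{P}(\mathbf{z}))\ge m\|\mathbf{x}-\mathbf{z}\|^2$ for all $\mathbf{x},\mathbf{z}\in\mathbb{R}^N$, where $\mathcal{P}(\mathbf{x})=\left[\frac{\partial f_1(\mathbf{x})}{\partial x_1},\dots,\frac{\partial f_N(\mathbf{x})}{\partial x_N}\right]^T$; (A3) the players have an undirected and connected communication graph with adjacency matrix $[a_{ij}]$; (A4) for each $i$, $\phi_i(x_i)$ and $\frac{\partial\phi_i(x_i)}{\partial x_i}$ are bounded provided that $x_i$ is bounded. Let the control input be $$u_i=N_0(k_i)\big(x_i-y_i+\phi_i(x_i)\hat\theta_i\big),\qquad N_0(k)=k^2\sin(k),$$ $$\dot k_i=(x_i-y_i)\big(x_i-y_i+\phi_i(x_i)\hat\theta_i\big),\qquad \dot{\hat\theta}_i=\phi_i(x_i)(x_i-y_i),$$ $$\dot y_i=-\nabla_i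 f_i(\mathbf{z}_i),\qquad \dot z_{ij}=-\delta_{ij}\Big(\sum_{k=1}^N a_{ik}(z_{ij}-z_{kj})+a_{ij}(z_{ij}-y_j)\Big),\quad i,j\in\mathcal{N},$$ where $\mathbf{z}_i=[z_{i1},\dots,z_{iN}]^T$, $\delta_{ij}=\delta\bar\delta_{ij}$, $\delta>0$ and $\bar\delta_{ij}>0$ are fixed constants. Then there exists a positive constant $\delta^*$ such that for each $\delta\in(\delta^*,\infty)$ (and every initial condition of the closed-loop system), $$\lim_{t\to\infty}\|\mathbf{x}(t)-\mathbf{x}^*\|=0,$$ and $k_i(t)$, $\hat\theta_i(t)$ stay bounded for all $i\in\mathcal{N}$, where $\mathbf{x}=[x_1,\dots,x_N]^T$ and $\mathbf{x}^*$ is the Nash equilibrium of the game.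
   Context: Notation: $\nabla_i f_i(\mathbf{z}_i)=\frac{\partial f_i(\mathbf{x})}{\partial x_i}\big|_{\mathbf{x}=\mathbf{z}_i}$; the variables $k_i,\hat\theta_i,y_i,z_{ij}$ are real-valued. An action profile $\mathbf{x}^*=(x_i^*,\mathbf{x}_{-i}^* )$ is a Nash equilibrium if for each $i\in\mathcal{N}$, $f_i(x_i^*,\mathbf{x}_{-i}^* )\le f_i(x_i,\mathbf{x}_{-i}^* )$ for all $x_i\in\mathbb{R}$, where $\mathbf{x}_{-i}=[x_1,\dots,x_{i-1},x_{i+1},\dots,x_N]^T$. The signs of the $b_i$ are unknown and need not coincide. Communication graph: node set $\mathcal{N}$, edge set $\mathcal{E}_d$; an edge $(i,j)\in\mathcal{E}_d$ means node $j$ can receive information from node $i$. The adjacency matrix satisfies $a_{ij}>0$ if $(j,i)\in\mathcal{E}_d$, $a_{ij}=0$ otherwise, and $a_{ii}=0$; for an undirected graph $a_{ij}=a_{ji}$. An undirected graph is connected if there is a path between any two distinct nodes. *)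

theory Defs
  imports "HOL-Analysis.Analysis"
begin

text \<open>
  Players are the elements of a finite type \<^typ>\<open>'n\<close>; an action profile is a vector in
  \<^typ>\<open>real^'n\<close>.
\<close>

definition set_action :: "real^'n \<Rightarrow> 'n::finite \<Rightarrow> real \<Rightarrow> real^'n" where
  "set_action x i s = (\<chi> j. if j = i then s else x $ j)"

definition nash_equilibrium :: "('n::finite \<Rightarrow> real^'n \<Rightarrow> real) \<Rightarrow> real^'n \<Rightarrow> bool" where
  "nash_equilibrium f x \<longleftrightarrow> (\<forall>i s. f i x \<le> f i (set_action x i s))"

definition partial_deriv :: "'n::finite \<Rightarrow> (real^'n \<Rightarrow> real) \<Rightarrow> real^'n \<Rightarrow> real" where
  "partial_deriv i g x = deriv (\<lambda>s. g (set_action x i s)) (x $ i)"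

definition pseudogradient :: "('n::finite \<Rightarrow> real^'n \<Rightarrow> real) \<Rightarrow> real^'n \<Rightarrow> real^'n" where
  "pseudogradient f x = (\<chi> i. partial_deriv i (f i) x)"

text \<open>
  Continuous Frechet differentiability on the whole space.  This is the order of smoothness at
  which every derivative occurring below exists and is continuous; any higher order implies it.
  For functions of one real variable the library's \<^const>\<open>C1_differentiable_on\<close> is used.
\<close>

definition C1_function :: "('a::real_normed_vector \<Rightarrow> real) \<Rightarrow> bool" where
  "C1_function g \<longleftrightarrow> (\<exists>g' :: 'a \<Rightarrow> 'a \<Rightarrow>\<^sub>L real.
     (\<forall>x. (g has_derivative blinfun_apply (g' x)) (at x)) \<and> continuous_on UNIV g')"

text \<open>
  An edge \<open>(i, j)\<close> means that \<open>j\<close> receives information from \<open>i\<close>, so the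
  weight \<open>a i j\<close> belongs to the edge \<open>(j, i)\<close>.
\<close>

definition adjacency_matrix :: "('n \<times> 'n) set \<Rightarrow> ('n \<Rightarrow> 'n \<Rightarrow> real) \<Rightarrow> bool" where
  "adjacency_matrix E a \<longleftrightarrow>
     (\<forall>i j. ((j, i) \<in> E \<longrightarrow> a i j > 0) \<and> ((j, i) \<notin> E \<longrightarrow> a i j = 0)) \<and> (\<forall>i. a i i = 0)"

definition undirected_graph :: "('n \<times> 'n) set \<Rightarrow> ('n \<Rightarrow> 'n \<Rightarrow> real) \<Rightarrow> bool" where
  "undirected_graph E a \<longleftrightarrow> sym E \<and> (\<forall>i j. a i j = a j i)"

definition connected_graph :: "('n \<times> 'n) set \<Rightarrow> bool" where
  "connected_graph E \<longleftrightarrow> (\<forall>i j. i \<noteq> j \<longrightarrow> (i, j) \<in> E\<^sup>+)"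

definition nussbaum :: "real \<Rightarrow> real" where
  "nussbaum k = k\<^sup>2 * sin k"

text \<open>
  A solution on \<open>{0..}\<close> of the plant in closed loop with the control law; \<open>\<theta>h\<close> is the
  parameter estimate, and row \<open>z t $ i\<close> is player \<open>i\<close>'s estimate of the whole profile
  \<open>y t\<close>.  The derivative at time 0 is one-sided.
\<close>

definition closed_loop_solution ::
  "('n::finite \<Rightarrow> real^'n \<Rightarrow> real) \<Rightarrow> ('n \<Rightarrow> real) \<Rightarrow> ('n \<Rightarrow> real) \<Rightarrow> ('n \<Rightarrow> real \<Rightarrow> real) \<Rightarrow>
   ('n \<Rightarrow> 'n \<Rightarrow> real) \<Rightarrow> ('n \<Rightarrow> 'n \<Rightarrow> real) \<Rightarrow>
   (real \<Rightarrow> real^'n) \<Rightarrow> (real \<Rightarrow> real^'n) \<Rightarrow> (real \<Rightarrow> real^'n) \<Rightarrow> (real \<Rightarrow> real^'n) \<Rightarrow>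
   (real \<Rightarrow> real^'n^'n) \<Rightarrow> bool" where
  "closed_loop_solution f b \<theta> \<phi> a \<delta> x k \<theta>h y z \<longleftrightarrow>
    (\<exists>u :: real \<Rightarrow> real^'n. \<forall>t\<ge>0. \<forall>i.
      u t $ i = nussbaum (k t $ i) * (x t $ i - y t $ i + \<phi> i (x t $ i) * \<theta>h t $ i) \<and>
      ((\<lambda>s. x s $ i) has_real_derivative
         b i * u t $ i + \<phi> i (x t $ i) * \<theta> i) (at t within {0..}) \<and>
      ((\<lambda>s. k s $ i) has_real_derivative
         (x t $ i - y t $ i) * (x t $ i - y t $ i + \<phi> i (x t $ i) * \<theta>h t $ i)) (at t within {0..}) \<and>
      ((\<lambda>s. \<theta>h s $ i) has_real_derivative
         \<phi> i (x t $ i) * (x t $ i - y t $ i)) (at t within {0..}) \<and>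
      ((\<lambda>s. y s $ i) has_real_derivative
         - partial_deriv i (f i) (z t $ i)) (at t within {0..}) \<and>
      (\<forall>j. ((\<lambda>s. z s $ i $ j) has_real_derivative
         - \<delta> i j * ((\<Sum>l\<in>UNIV. a i l * (z t $ i $ j - z t $ l $ j))
                    + a i j * (z t $ i $ j - y t $ j))) (at t within {0..})))"

end

theory Submission
  imports Defs
begin

text \<open>
  The closed loop is a cascade.  The pair \<open>(y, z)\<close> evolves on its own; player \<open>i\<close> then only sees
  the reference signal \<open>y\<^sub>i\<close>, and its state \<open>(x\<^sub>i, k\<^sub>i, \<theta>h\<^sub>i)\<close> does not act on anybody else.

  \<^emph>\<open>The equilibrium.\<close>  Along a unilateral deviation, monotonicity fixes the sign of the own-cost
  derivative, so Nash equilibria are exactly the zeros of the pseudogradient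
  (\<open>nash_equilibrium_iff_pseudogradient_zero\<close>).  A strongly monotone Lipschitz map has exactly one
  zero, since a small step against the map is a contraction (\<open>strongly_monotone_unique_zero\<close>).

  \<^emph>\<open>The reference.\<close>  Put \<open>e\<^sub>i\<^sub>j = z\<^sub>i\<^sub>j - y\<^sub>j\<close>.  The energy
  \<open>(\<Sum>\<^sub>j (y\<^sub>j - xs\<^sub>j)\<^sup>2 + \<Sum>\<^sub>i\<^sub>j e\<^sub>i\<^sub>j\<^sup>2 / \<delta>b\<^sub>i\<^sub>j) / 2\<close>, in which the weights \<open>\<delta>b\<close> cancel against the
  individual rates, decreases by \<open>m |y - xs|\<^sup>2\<close> through strong monotonicity and by \<open>\<delta>\<close> times a
  graph quadratic form through consensus.  This form is positive definite because the graph is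
  connected and every node \<open>j\<close> has a neighbour that measures \<open>y\<^sub>j\<close> directly.  The coupling terms are
  Lipschitz-bounded, so a large \<open>\<delta>\<close> absorbs them, and \<open>y \<rightarrow> xs\<close> exponentially together with the
  derivative of \<open>y\<close> (\<open>seeking_exponential_convergence\<close>).

  \<^emph>\<open>The tracking.\<close>  For one player, \<open>W = ((x - y)\<^sup>2 + (\<theta>h - \<theta>)\<^sup>2) / 2\<close> satisfies
  \<open>W' = (b N(k) + 1) k' - (x - y)\<^sup>2 - (x - y) y'\<close>, whatever the sign of \<open>b\<close>.  The first term is the
  derivative of \<open>G(k)\<close>, where \<open>G\<close> is an explicit primitive that takes arbitrarily negative
  values on both sides of \<open>0\<close>.  Integration gives \<open>0 \<le> W \<le> G(k) + const\<close>, so \<open>k\<close> cannot get past a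
  point where \<open>G\<close> is too negative: \<open>k\<close>, and with it \<open>W\<close>, stays bounded
  (\<open>player_a_priori_bound\<close>).  The remaining dissipation \<open>(x - y)\<^sup>2 / 2\<close> then has a finite integral and
  a bounded derivative, hence tends to \<open>0\<close> (\<open>player_convergence\<close>).

  \<^emph>\<open>Existence.\<close>  The vector field is Lipschitz only on bounded sets.  The two estimates above hold
  on every compact time interval with bounds that depend on the initial data alone.  A field
  truncated outside a larger ball has global solutions by Picard iteration, and the estimates
  prevent them from ever noticing the truncation (\<open>global_solution_of_a_priori_bound\<close>).
\<close>

section \<open>Differential inequalities on the half line\<close>

lemma antitone_of_nonpos_derivative:
  fixes V :: "real \<Rightarrow> real"
  assumes deriv: "\<And>t. t \<in> S \<Longrightarrow> (V has_real_derivative V' t) (at t within S)"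
    and nonpos: "\<And>t. t \<in> S \<Longrightarrow> V' t \<le> 0"
    and "r \<le> s" "{r..s} \<subseteq> S"
  shows "V s \<le> V r"
proof (rule DERIV_nonpos_imp_decreasing_open[OF \<open>r \<le> s\<close>])
  have d: "(V has_real_derivative V' t) (at t within {r..s})" if "t \<in> {r..s}" for t
    by (rule DERIV_subset[OF deriv[OF subsetD[OF assms(4) that]] assms(4)])
  show "continuous_on {r..s} V"
    by (rule DERIV_continuous_on[OF d])
  fix t assume t: "r < t" "t < s"
  have "at t within {r..s} = at t" using t by (intro at_within_interior) simp
  moreover have "t \<in> {r..s}" using t by simp
  ultimately have "DERIV V t :> V' t" "V' t \<le> 0"
    using d[of t] nonpos[of t] assms(4) by auto
  then show "\<exists>y. DERIV V t :> y \<and> y \<le> 0" by blast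
qed

text \<open>
  The function \<open>V t * exp (c * t)\<close> is nonincreasing.
\<close>

lemma exponential_decay:
  fixes V :: "real \<Rightarrow> real"
  assumes "\<And>t. t \<in> {0..T} \<Longrightarrow> (V has_real_derivative V' t) (at t within {0..T})"
    and "\<And>t. t \<in> {0..T} \<Longrightarrow> V' t \<le> - c * V t"
    and "t \<in> {0..T}"
  shows "V t \<le> V 0 * exp (- c * t)"
proof -
  have "V t * exp (c * t) \<le> V 0 * exp (c * 0)"
  proof (rule antitone_of_nonpos_derivative[where S = "{0..T}" and V = "\<lambda>s. V s * exp (c * s)"])
    fix s assume s: "s \<in> {0..T}"
    show "((\<lambda>s. V s * exp (c * s)) has_real_derivative (V' s + c * V s) * exp (c * s)) (at s within {0..T})"
      using assms(1)[OF s] by (auto intro!: derivative_eq_intros simp: algebra_simps)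
    show "(V' s + c * V s) * exp (c * s) \<le> 0"
      using assms(2)[OF s] by (intro mult_nonpos_nonneg) auto
  qed (use assms(3) in auto)
  then show ?thesis by (simp add: exp_minus field_simps)
qed

text \<open>
  A form of Barbalat's lemma in which \<open>H\<close> replaces the integral of \<open>h\<close>.  Whenever \<open>h t \<ge> \<epsilon>\<close>, the bound on
  \<open>h'\<close> keeps \<open>h\<close> above \<open>\<epsilon> / 2\<close> for a fixed time \<open>\<eta>\<close>, so that \<open>H\<close> loses at least \<open>\<eta> \<epsilon> / 2\<close>.  Once \<open>H\<close> is
  closer than this to its infimum, that cannot happen any more.
\<close>

lemma tendsto_zero_of_dissipation:
  fixes H h :: "real \<Rightarrow> real"
  assumes H: "\<And>t. t \<ge> 0 \<Longrightarrow> (H has_real_derivative H' t) (at t within {0..})"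
    and diss: "\<And>t. t \<ge> 0 \<Longrightarrow> H' t \<le> - h t"
    and below: "\<And>t. t \<ge> 0 \<Longrightarrow> - B \<le> H t"
    and h: "\<And>t. t \<ge> 0 \<Longrightarrow> (h has_real_derivative h' t) (at t within {0..})"
    and h_lip: "\<And>t. t \<ge> 0 \<Longrightarrow> \<bar>h' t\<bar> \<le> M"
    and h_nonneg: "\<And>t. t \<ge> 0 \<Longrightarrow> 0 \<le> h t"
  shows "(h \<longlongrightarrow> 0) at_top"
proof (rule tendstoI)
  fix \<epsilon> :: real assume \<epsilon>: "\<epsilon> > 0"
  have M: "M \<ge> 0" using h_lip[of 0] by linarith
  define \<eta> where "\<eta> = \<epsilon> / (2 * (M + 1))"
  have \<eta>: "\<eta> > 0" "M * \<eta> \<le> \<epsilon> / 2" using \<epsilon> M by (auto simp: \<eta>_def field_simps)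
  have anti: "H s \<le> H r" if "0 \<le> r" "r \<le> s" for r s
  proof (rule antitone_of_nonpos_derivative[where S = "{0..}" and V = H and V' = H'])
    show "H' q \<le> 0" if "q \<in> {0..}" for q
      using diss[of q] h_nonneg[of q] that by auto
  qed (use H that in auto)
  define I where "I = Inf (H ` {0..})"
  have bdd: "bdd_below (H ` {0..})" using below by (intro bdd_belowI[of _ "-B"]) auto
  have "I < I + \<eta> * (\<epsilon> / 2)" using \<eta> \<epsilon> by simp
  then obtain t0 where t0: "t0 \<ge> 0" "H t0 < I + \<eta> * (\<epsilon> / 2)"
    unfolding I_def using cInf_less_iff[OF _ bdd, of "Inf (H ` {0..}) + \<eta> * (\<epsilon> / 2)"] by auto
  have "h t < \<epsilon>" if t: "t \<ge> t0" for t
  proof (rule ccontr)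
    assume "\<not> h t < \<epsilon>"
    have t_nn: "t \<ge> 0" using t t0 by simp
    have h_ge: "h s \<ge> \<epsilon> / 2" if s: "s \<in> {t..t + \<eta>}" for s
    proof -
      have "- h s - M * s \<le> - h t - M * t"
      proof (rule antitone_of_nonpos_derivative[where S = "{0..}" and V = "\<lambda>s. - h s - M * s"])
        fix r :: real assume r: "r \<in> {0..}"
        show "((\<lambda>s. - h s - M * s) has_real_derivative - h' r - M) (at r within {0..})"
          using h[of r] r by (auto intro!: derivative_eq_intros)
        show "- h' r - M \<le> 0" using h_lip[of r] r by auto
      qed (use s t_nn in auto)
      then have "h s \<ge> h t - M * (s - t)" by (simp add: algebra_simps)
      moreover have "M * (s - t) \<le> M * \<eta>" using s M by (intro mult_left_mono) auto
      ultimately show ?thesis using \<eta> \<open>\<not> h t < \<epsilon>\<close> by linarith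
    qed
    have "H (t + \<eta>) + \<epsilon> / 2 * (t + \<eta>) \<le> H t + \<epsilon> / 2 * t"
    proof (rule antitone_of_nonpos_derivative[where S = "{t..t + \<eta>}" and V = "\<lambda>s. H s + \<epsilon> / 2 * s"])
      fix s assume s: "s \<in> {t..t + \<eta>}"
      have "(H has_real_derivative H' s) (at s within {t..t + \<eta>})"
        using H[of s] s t_nn by (auto intro: DERIV_subset)
      then show "((\<lambda>s. H s + \<epsilon> / 2 * s) has_real_derivative H' s + \<epsilon> / 2) (at s within {t..t + \<eta>})"
        by (auto intro!: derivative_eq_intros)
      show "H' s + \<epsilon> / 2 \<le> 0" using diss[of s] h_ge[OF s] s t_nn by auto
    qed (use \<eta> in auto)
    moreover have "I \<le> H (t + \<eta>)"
      unfolding I_def using bdd t_nn \<eta> by (intro cInf_lower) auto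
    moreover have "H t \<le> H t0" using anti t t0 by simp
    ultimately show False using t0 unfolding distrib_left by (simp add: mult.commute[of \<eta>])
  qed
  then show "eventually (\<lambda>t. dist (h t) 0 < \<epsilon>) at_top"
    using h_nonneg t0 by (intro eventually_at_top_linorderI[of t0]) auto
qed

section \<open>Tracking with a Nussbaum gain\<close>

text \<open>
  A primitive of \<open>b * nussbaum k + 1\<close>.
\<close>

definition nussbaum_primitive :: "real \<Rightarrow> real \<Rightarrow> real" where
  "nussbaum_primitive b k = b * (- k\<^sup>2 * cos k + 2 * k * sin k + 2 * cos k) + k"

lemma nussbaum_primitive_deriv:
  "(nussbaum_primitive b has_real_derivative b * (k\<^sup>2 * sin k) + 1) (at k within S)"
  unfolding nussbaum_primitive_def
  by (auto intro!: derivative_eq_intros simp: algebra_simps power2_eq_square)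

text \<open>
  At the multiples \<open>K\<close> of \<open>\<pi>\<close> with \<open>b * cos K = \<bar>b\<bar>\<close> the value at \<open>\<plusminus>K\<close> is \<open>- \<bar>b\<bar> * K\<^sup>2 + 2 * \<bar>b\<bar> \<plusminus> K\<close>.
  Choosing the parity of the multiple by the sign of \<open>b\<close> is what makes the sign irrelevant.
\<close>

lemma nussbaum_primitive_unbounded_below:
  assumes "b \<noteq> 0"
  obtains K where "K > R" "nussbaum_primitive b K < - C" "nussbaum_primitive b (- K) < - C"
proof -
  define \<sigma> :: real where "\<sigma> = (if b > 0 then 0 else pi)"
  define K where "K n = 2 * pi * real n + \<sigma>" for n
  have Kn: "real n \<le> K n" for n
    using pi_gt3 mult_right_mono[of 1 "2 * pi" "real n"] by (auto simp: K_def \<sigma>_def)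
  have cosK: "b * cos (K n) = \<bar>b\<bar>" for n
    using assms cos_npi2[of "2 * n"] by (auto simp: K_def \<sigma>_def cos_add mult_ac)
  have sinK: "sin (K n) = 0" for n
    using sin_npi[of "2 * n"] by (auto simp: K_def \<sigma>_def sin_add mult_ac)
  obtain n where n: "real n > \<bar>R\<bar> + \<bar>C\<bar> + 2 * \<bar>b\<bar> + 1 + 2 / \<bar>b\<bar>"
    using reals_Archimedean2 by blast
  then have big: "K n > \<bar>R\<bar> + \<bar>C\<bar> + 2 * \<bar>b\<bar> + 1 + 2 / \<bar>b\<bar>" using Kn[of n] by linarith
  have Kpos: "K n > 0" "K n > R" using big by (smt (verit) divide_nonneg_nonneg)+
  \<comment> \<open>This makes the quadratic term at least twice the linear one.\<close>
  have "\<bar>b\<bar> * K n \<ge> 2" 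
  proof -
    have "K n \<ge> 2 / \<bar>b\<bar>" using big by linarith
    then show ?thesis using assms by (simp add: field_simps)
  qed
  then have "(\<bar>b\<bar> * K n) * K n \<ge> 2 * K n" using Kpos by (intro mult_right_mono) auto
  moreover have "K n > \<bar>C\<bar> + 2 * \<bar>b\<bar>" using big by (smt (verit) divide_nonneg_nonneg)
  ultimately have n: "\<bar>b\<bar> * (K n)\<^sup>2 - 2 * \<bar>b\<bar> - K n > C"
    unfolding power2_eq_square mult.assoc[symmetric] by linarith
  have G: "nussbaum_primitive b (K n) = - \<bar>b\<bar> * (K n)\<^sup>2 + 2 * \<bar>b\<bar> + K n"
    "nussbaum_primitive b (- K n) = - \<bar>b\<bar> * (K n)\<^sup>2 + 2 * \<bar>b\<bar> - K n"
    unfolding nussbaum_primitive_def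
    by (simp_all add: sinK distrib_left right_diff_distrib cosK mult.left_commute[of b])
  show thesis by (rule that[of "K n"]) (use n G Kpos in auto)
qed

text \<open>
  By continuity \<open>k\<close> would have to cross \<open>K\<close> or \<open>- K\<close>, where the primitive lies below \<open>- C\<close>.  The bound
  depends on the data \<open>k0\<close> and \<open>C\<close> only, not on the time interval.
\<close>

lemma nussbaum_gain_bound:
  assumes "b \<noteq> 0"
  obtains K where "\<And>(k :: real \<Rightarrow> real) T t. k 0 = k0 \<Longrightarrow> continuous_on {0..T} k \<Longrightarrow>
     (\<And>s. s \<in> {0..T} \<Longrightarrow> - C \<le> nussbaum_primitive b (k s)) \<Longrightarrow> t \<in> {0..T} \<Longrightarrow> \<bar>k t\<bar> \<le> K"
proof -
  obtain K where K: "K > \<bar>k0\<bar>" "nussbaum_primitive b K < - C" "nussbaum_primitive b (- K) < - C"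
    using nussbaum_primitive_unbounded_below[OF assms] by metis
  have "\<bar>k t\<bar> \<le> K" if k: "k 0 = k0" "continuous_on {0..T} k" 
    "\<And>s. s \<in> {0..T} \<Longrightarrow> - C \<le> nussbaum_primitive b (k s)" and t: "t \<in> {0..T}" for k :: "real \<Rightarrow> real" and T t
  proof (rule ccontr)
    assume "\<not> \<bar>k t\<bar> \<le> K"
    have "continuous_on {0..t} (\<lambda>s. \<bar>k s\<bar>)"
      using t by (intro continuous_on_rabs continuous_on_subset[OF k(2)]) auto
    then obtain s where "s \<in> {0..t}" "\<bar>k s\<bar> = K"
      using IVT'[of "\<lambda>s. \<bar>k s\<bar>" 0 K t] K t k(1) \<open>\<not> \<bar>k t\<bar> \<le> K\<close> by auto
    then show False using k(3)[of s] K t by (auto simp: abs_if split: if_splits)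
  qed
  then show thesis using that by blast
qed

text \<open>
  The plant, adaptation and gain equations of a single player, which regards its reference \<open>y\<close>
  as an exogenous signal with derivative \<open>y'\<close>.  The time set \<open>S\<close> is a parameter because the same
  equations are needed on compact intervals (for the existence of solutions) and on the half line.
\<close>

definition player_solution_on where
  "player_solution_on S b \<theta> \<phi> x k h y y' \<longleftrightarrow> (\<forall>t\<in>S.
     (x has_real_derivative b * (nussbaum (k t) * (x t - y t + \<phi> (x t) * h t)) + \<phi> (x t) * \<theta>) (at t within S) \<and>
     (k has_real_derivative (x t - y t) * (x t - y t + \<phi> (x t) * h t)) (at t within S) \<and>
     (h has_real_derivative \<phi> (x t) * (x t - y t)) (at t within S) \<and>
     (y has_real_derivative y' t) (at t within S))"

text \<open>
  The Lyapunov function of the tracking loop.  The last summand pays for the disturbance: its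
  derivative \<open>- C\<^sup>2 / 2 * exp (- (2 * c * t))\<close> is at most \<open>- (y' t)\<^sup>2 / 2\<close> when
  \<open>\<bar>y' t\<bar> \<le> C * exp (- (c * t))\<close>.
\<close>

definition player_energy where
  "player_energy b \<theta> C c x k h y t =
     ((x t - y t)\<^sup>2 + (h t - \<theta>)\<^sup>2) / 2 - nussbaum_primitive b (k t) + C\<^sup>2 / (4 * c) * exp (- (2 * c * t))"

text \<open>
  The adaptation law removes the unknown \<open>\<theta>\<close> from the derivative of the quadratic part, and the
  choice of \<open>k'\<close> turns the control term into \<open>(b * nussbaum k + 1) * k'\<close>, which the primitive cancels.
  What is left is \<open>- (x - y)\<^sup>2\<close> and the cross term with \<open>y'\<close>, split by Young's inequality.
\<close>

lemma player_energy_dissipation: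
  assumes sol: "player_solution_on S b \<theta> \<phi> x k h y y'" and "t \<in> S"
    and y': "\<bar>y' t\<bar> \<le> C * exp (- (c * t))" and "c > 0"
  shows "(player_energy b \<theta> C c x k h y has_real_derivative
      - (x t - y t)\<^sup>2 - (x t - y t) * y' t - C\<^sup>2 / 2 * exp (- (2 * c * t))) (at t within S)"
    and "- (x t - y t)\<^sup>2 - (x t - y t) * y' t - C\<^sup>2 / 2 * exp (- (2 * c * t)) \<le> - ((x t - y t)\<^sup>2 / 2)"
proof -
  note d = sol[unfolded player_solution_on_def, rule_format, OF \<open>t \<in> S\<close>]
  have dx: "(x has_real_derivative b * (nussbaum (k t) * (x t - y t + \<phi> (x t) * h t)) + \<phi> (x t) * \<theta>) (at t within S)"
    and dk: "(k has_real_derivative (x t - y t) * (x t - y t + \<phi> (x t) * h t)) (at t within S)"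
    and dh: "(h has_real_derivative \<phi> (x t) * (x t - y t)) (at t within S)"
    and dy: "(y has_real_derivative y' t) (at t within S)"
    using d by auto
  note dG = DERIV_chain2[OF nussbaum_primitive_deriv[of b "k t" UNIV] dk]
  have dE: "((\<lambda>t. C\<^sup>2 / (4 * c) * exp (- (2 * c * t))) has_real_derivative
      C\<^sup>2 / (4 * c) * (exp (- (2 * c * t)) * - (2 * c))) (at t within S)"
    by (auto intro!: derivative_eq_intros)
  show "(player_energy b \<theta> C c x k h y has_real_derivative
      - (x t - y t)\<^sup>2 - (x t - y t) * y' t - C\<^sup>2 / 2 * exp (- (2 * c * t))) (at t within S)"
    unfolding player_energy_def[abs_def]
    by (rule DERIV_cong[OF DERIV_add[OF DERIV_diff[OF DERIV_cdivide[OF DERIV_add[OF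
          DERIV_power[OF DERIV_diff[OF dx dy], of 2]
          DERIV_power[OF DERIV_diff[OF dh DERIV_const[of \<theta>]], of 2]], of 2] dG] dE]])
       (use \<open>c > 0\<close> in \<open>simp add: nussbaum_def field_simps power2_eq_square\<close>)
  have "(y' t)\<^sup>2 \<le> (C * exp (- (c * t)))\<^sup>2"
    using power_mono[OF y', of 2] by simp
  also have "\<dots> = C\<^sup>2 * exp (- (2 * c * t))"
    by (simp add: power_mult_distrib exp_double[symmetric] algebra_simps)
  finally have "(y' t)\<^sup>2 / 2 \<le> C\<^sup>2 / 2 * exp (- (2 * c * t))" by simp
  moreover have "0 \<le> ((x t - y t) + y' t)\<^sup>2" by simp
  ultimately show "- (x t - y t)\<^sup>2 - (x t - y t) * y' t - C\<^sup>2 / 2 * exp (- (2 * c * t)) \<le> - ((x t - y t)\<^sup>2 / 2)"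
    unfolding power2_sum by linarith
qed

lemma nussbaum_primitive_bounded:
  obtains G where "\<And>k. \<bar>k\<bar> \<le> K \<Longrightarrow> \<bar>nussbaum_primitive b k\<bar> \<le> G"
proof -
  have "continuous_on {-K..K} (nussbaum_primitive b)"
    unfolding nussbaum_primitive_def by (intro continuous_intros)
  then have "bounded (nussbaum_primitive b ` {-K..K})"
    by (intro compact_imp_bounded compact_continuous_image) auto
  then obtain G where "\<forall>v\<in>nussbaum_primitive b ` {-K..K}. norm v \<le> G"
    unfolding bounded_iff by blast
  then show thesis using that[of G] by (auto simp: abs_le_iff)
qed

text \<open>
  The energy never exceeds its initial value \<open>H0\<close>.  As its quadratic part is nonnegative, this
  bounds the primitive at \<open>k t\<close> from below, hence \<open>k\<close>, and then in turn the quadratic part.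
\<close>

lemma player_a_priori_bound:
  assumes "b \<noteq> 0" "c > 0"
  obtains B where "\<And>T x k h y y' t.
      player_solution_on {0..T} b \<theta> \<phi> x k h y y' \<Longrightarrow>
      (\<And>t. t \<in> {0..T} \<Longrightarrow> \<bar>y' t\<bar> \<le> C * exp (- (c * t))) \<Longrightarrow>
      x 0 = x0 \<Longrightarrow> k 0 = k0 \<Longrightarrow> h 0 = h0 \<Longrightarrow> y 0 = y0 \<Longrightarrow> t \<in> {0..T} \<Longrightarrow>
      \<bar>x t - y t\<bar> \<le> B \<and> \<bar>k t\<bar> \<le> B \<and> \<bar>h t\<bar> \<le> B"
proof -
  define H0 where "H0 = ((x0 - y0)\<^sup>2 + (h0 - \<theta>)\<^sup>2) / 2 - nussbaum_primitive b k0 + C\<^sup>2 / (4 * c)"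
  obtain K where K: "\<And>(k :: real \<Rightarrow> real) T t. k 0 = k0 \<Longrightarrow> continuous_on {0..T} k \<Longrightarrow>
     (\<And>s. s \<in> {0..T} \<Longrightarrow> - H0 \<le> nussbaum_primitive b (k s)) \<Longrightarrow> t \<in> {0..T} \<Longrightarrow> \<bar>k t\<bar> \<le> K"
    using nussbaum_gain_bound[OF \<open>b \<noteq> 0\<close>, of k0 H0] by metis
  obtain G where G: "\<And>k. \<bar>k\<bar> \<le> K \<Longrightarrow> \<bar>nussbaum_primitive b k\<bar> \<le> G"
    using nussbaum_primitive_bounded by metis
  \<comment> \<open>From \<open>u\<^sup>2 \<le> 2 * (H0 + G)\<close> the bound \<open>\<bar>u\<bar> \<le> H0 + G + 1\<close> follows without square roots.\<close>
  define B where "B = \<bar>K\<bar> + \<bar>H0 + G\<bar> + 1 + \<bar>\<theta>\<bar>"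
  have "\<bar>x t - y t\<bar> \<le> B \<and> \<bar>k t\<bar> \<le> B \<and> \<bar>h t\<bar> \<le> B"
    if sol: "player_solution_on {0..T} b \<theta> \<phi> x k h y y'"
      and y': "\<And>t. t \<in> {0..T} \<Longrightarrow> \<bar>y' t\<bar> \<le> C * exp (- (c * t))"
      and init: "x 0 = x0" "k 0 = k0" "h 0 = h0" "y 0 = y0"
      and t: "t \<in> {0..T}"
    for T x k h y y' t
  proof -
    have H: "player_energy b \<theta> C c x k h y s \<le> H0" if s: "s \<in> {0..T}" for s
    proof -
      have "player_energy b \<theta> C c x k h y s \<le> player_energy b \<theta> C c x k h y 0"
      proof (rule antitone_of_nonpos_derivative[where S = "{0..T}" and V = "player_energy b \<theta> C c x k h y"])
        fix r assume r: "r \<in> {0..T}"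
        note diss = player_energy_dissipation[OF sol r y'[OF r] \<open>c > 0\<close>]
        show "(player_energy b \<theta> C c x k h y has_real_derivative
           - (x r - y r)\<^sup>2 - (x r - y r) * y' r - C\<^sup>2 / 2 * exp (- (2 * c * r))) (at r within {0..T})"
          by (rule diss(1))
        show "- (x r - y r)\<^sup>2 - (x r - y r) * y' r - C\<^sup>2 / 2 * exp (- (2 * c * r)) \<le> 0"
          using diss(2) by (rule order_trans) simp
      qed (use s in auto)
      then show ?thesis by (simp add: player_energy_def H0_def init)
    qed
    have exp_term: "0 \<le> C\<^sup>2 / (4 * c) * exp (- (2 * c * s))" for s
      using \<open>c > 0\<close> by simp
    have gain: "- H0 \<le> nussbaum_primitive b (k s)" if "s \<in> {0..T}" for s
    proof -
      have "- H \<le> g" if "w / 2 - g + e \<le> H" "0 \<le> e" "0 \<le> w" for w g e H :: real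
        using that by linarith
      from this[OF H[OF that, unfolded player_energy_def] exp_term sum_power2_ge_zero] show ?thesis .
    qed
    have "continuous_on {0..T} k"
      using sol unfolding player_solution_on_def by (intro DERIV_continuous_on) blast
    then have k: "\<bar>k t\<bar> \<le> K" using K[of k T t] init gain t by blast
    have W: "(x t - y t)\<^sup>2 + (h t - \<theta>)\<^sup>2 \<le> 2 * H0 + 2 * G"
    proof -
      have "w \<le> 2 * H + 2 * G" if "w / 2 - g + e \<le> H" "0 \<le> e" "g \<le> G" for w g e H G :: real
      proof -
        have "w / 2 \<le> H + G" using that by linarith
        then show ?thesis by simp
      qed
      from this[OF H[OF t, unfolded player_energy_def] exp_term abs_le_D1[OF G[OF k]]] show ?thesis .
    qed
    have sq: "\<bar>u\<bar> \<le> H0 + G + 1" if "u\<^sup>2 \<le> 2 * H0 + 2 * G" for u :: real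
    proof -
      have "0 \<le> (\<bar>u\<bar> - 1)\<^sup>2" by simp
      then have "2 * \<bar>u\<bar> \<le> u\<^sup>2 + 1" by (simp add: power2_diff)
      then show ?thesis using that by linarith
    qed
    have "\<bar>x t - y t\<bar> \<le> H0 + G + 1" "\<bar>h t - \<theta>\<bar> \<le> H0 + G + 1"
      using W by (intro sq; smt (verit) zero_le_power2)+
    then show ?thesis using k unfolding B_def by linarith
  qed
  then show thesis using that[of B] by blast
qed

text \<open>
  The dissipation lemma for the player energy and \<open>h = (x - y)\<^sup>2 / 2\<close>.  All signals are bounded by the
  a priori bound on the intervals \<open>{0..t}\<close>, so \<open>x\<close>, \<open>\<phi> x\<close> and therefore \<open>h'\<close> are bounded too.
\<close>

lemma player_convergence:
  assumes "b \<noteq> 0" "c > 0"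
    and sol: "player_solution_on {0..} b \<theta> \<phi> x k h y y'"
    and y': "\<And>t. t \<ge> 0 \<Longrightarrow> \<bar>y' t\<bar> \<le> C * exp (- (c * t))"
    and y: "\<And>t. t \<ge> 0 \<Longrightarrow> \<bar>y t\<bar> \<le> Y"
    and \<phi>: "\<And>S. bounded S \<Longrightarrow> bounded (\<phi> ` S)"
  shows "((\<lambda>t. x t - y t) \<longlongrightarrow> 0) at_top" "bounded (k ` {0..})" "bounded (h ` {0..})"
proof -
  obtain B where B: "\<And>T t. player_solution_on {0..T} b \<theta> \<phi> x k h y y' \<Longrightarrow> t \<in> {0..T} \<Longrightarrow>
      \<bar>x t - y t\<bar> \<le> B \<and> \<bar>k t\<bar> \<le> B \<and> \<bar>h t\<bar> \<le> B"
    using player_a_priori_bound[OF assms(1,2), of \<theta> \<phi> C "x 0" "k 0" "h 0" "y 0"] y'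
    by (metis atLeastAtMost_iff)
  have "player_solution_on {0..t} b \<theta> \<phi> x k h y y'" for t
    using sol unfolding player_solution_on_def
    by (auto intro: DERIV_subset[where s = "{0..}"])
  then have bounds: "\<bar>x t - y t\<bar> \<le> B" "\<bar>k t\<bar> \<le> B" "\<bar>h t\<bar> \<le> B" if "t \<ge> 0" for t
    using B[of t t] that by auto
  show "bounded (k ` {0..})" "bounded (h ` {0..})"
    using bounds by (auto simp: bounded_iff)
  have B0: "B \<ge> 0" using bounds(1)[of 0] by linarith
  have "bounded (\<phi> ` {- (B + Y)..B + Y})" by (rule \<phi>) simp
  then obtain \<Phi> where "\<forall>v\<in>\<phi> ` {- (B + Y)..B + Y}. norm v \<le> \<Phi>" unfolding bounded_iff by blast
  then have \<Phi>: "\<bar>\<phi> (x t)\<bar> \<le> \<Phi>" if "t \<ge> 0" for t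
    using bounds(1)[OF that] y[OF that] by (auto simp: abs_le_iff)
  have \<Phi>0: "\<Phi> \<ge> 0" using \<Phi>[of 0] by linarith
  obtain G where G: "\<And>k. \<bar>k\<bar> \<le> B \<Longrightarrow> \<bar>nussbaum_primitive b k\<bar> \<le> G"
    using nussbaum_primitive_bounded by metis
  have C0: "C \<ge> 0" using y'[of 0] by simp
  have "((\<lambda>t. (x t - y t)\<^sup>2 / 2) \<longlongrightarrow> 0) at_top"
  proof (rule tendsto_zero_of_dissipation[where H = "player_energy b \<theta> C c x k h y"])
    fix t :: real assume t: "t \<ge> 0"
    then have "t \<in> {0..}" by simp
    note d = sol[unfolded player_solution_on_def, rule_format, OF this]
    note diss = player_energy_dissipation[OF sol \<open>t \<in> {0..}\<close> y'[OF t] \<open>c > 0\<close>]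
    show "(player_energy b \<theta> C c x k h y has_real_derivative
           - (x t - y t)\<^sup>2 - (x t - y t) * y' t - C\<^sup>2 / 2 * exp (- (2 * c * t))) (at t within {0..})"
      by (rule diss(1))
    show "- (x t - y t)\<^sup>2 - (x t - y t) * y' t - C\<^sup>2 / 2 * exp (- (2 * c * t)) \<le> - ((x t - y t)\<^sup>2 / 2)"
      by (rule diss(2))
    have "0 \<le> C\<^sup>2 / (4 * c) * exp (- (2 * c * t))" using \<open>c > 0\<close> by simp
    note exp_term = this
    have arith: "- G \<le> w / 2 - g + e" if "g \<le> G" "0 \<le> e" "0 \<le> w" for w g e G :: real
      using that by linarith
    show "- G \<le> player_energy b \<theta> C c x k h y t"
      unfolding player_energy_def
      by (rule arith[OF abs_le_D1[OF G[OF bounds(2)[OF t]]] exp_term sum_power2_ge_zero])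
    let ?v = "b * (nussbaum (k t) * (x t - y t + \<phi> (x t) * h t)) + \<phi> (x t) * \<theta>"
    have "((\<lambda>t. (x t - y t)\<^sup>2) has_real_derivative 2 * (x t - y t) ^ 1 * (?v - y' t)) (at t within {0..})"
      using d by (auto intro!: derivative_eq_intros)
    then show "((\<lambda>t. (x t - y t)\<^sup>2 / 2) has_real_derivative (x t - y t) * (?v - y' t)) (at t within {0..})"
      by (rule DERIV_cong[OF DERIV_cdivide[of _ _ _ _ 2]]) simp
    have "\<bar>nussbaum (k t)\<bar> \<le> B\<^sup>2"
    proof -
      have "\<bar>nussbaum (k t)\<bar> = \<bar>k t\<bar>\<^sup>2 * \<bar>sin (k t)\<bar>" by (simp add: nussbaum_def abs_mult)
      also have "\<dots> \<le> B\<^sup>2 * 1" using bounds(2)[OF t] by (intro mult_mono power_mono) auto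
      finally show ?thesis by simp
    qed
    moreover have "\<bar>x t - y t + \<phi> (x t) * h t\<bar> \<le> B + \<Phi> * B"
      using bounds[OF t] \<Phi>[OF t] \<Phi>0
      by (intro order_trans[OF abs_triangle_ineq] add_mono) (auto simp: abs_mult intro!: mult_mono)
    ultimately have "\<bar>b * (nussbaum (k t) * (x t - y t + \<phi> (x t) * h t))\<bar> \<le> \<bar>b\<bar> * (B\<^sup>2 * (B + \<Phi> * B))"
      unfolding abs_mult by (intro mult_left_mono mult_mono) auto
    moreover have "\<bar>\<phi> (x t) * \<theta>\<bar> \<le> \<Phi> * \<bar>\<theta>\<bar>"
      using \<Phi>[OF t] by (auto simp: abs_mult intro!: mult_right_mono)
    moreover have "\<bar>y' t\<bar> \<le> C"
      using y'[OF t] mult_left_mono[of "exp (- (c * t))" 1 C] C0 \<open>c > 0\<close> t by auto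
    ultimately have "\<bar>?v - y' t\<bar> \<le> \<bar>b\<bar> * (B\<^sup>2 * (B + \<Phi> * B)) + \<Phi> * \<bar>\<theta>\<bar> + C"
      by linarith
    then show "\<bar>(x t - y t) * (?v - y' t)\<bar> \<le> B * (\<bar>b\<bar> * (B\<^sup>2 * (B + \<Phi> * B)) + \<Phi> * \<bar>\<theta>\<bar> + C)"
      using bounds(1)[OF t] B0 unfolding abs_mult[of "x t - y t"] by (intro mult_mono) auto
  qed auto
  then have "((\<lambda>t. 2 * ((x t - y t)\<^sup>2 / 2)) \<longlongrightarrow> 2 * 0) at_top" by (intro tendsto_mult tendsto_const)
  then have "((\<lambda>t. sqrt ((x t - y t)\<^sup>2)) \<longlongrightarrow> sqrt 0) at_top" by (intro tendsto_real_sqrt) simp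
  then show "((\<lambda>t. x t - y t) \<longlongrightarrow> 0) at_top" by (simp add: tendsto_rabs_zero_iff)
qed

section \<open>Nash equilibria of strongly monotone games\<close>

lemma set_action_nth: "set_action x i s $ j = (if j = i then s else x $ j)"
  by (simp add: set_action_def)

lemma set_action_same [simp]: "set_action x i (x $ i) = x"
  by (simp add: vec_eq_iff set_action_nth)

lemma set_action_twice [simp]: "set_action (set_action x i r) i s = set_action x i s"
  by (simp add: vec_eq_iff set_action_nth)

lemma set_action_eq_axis: "set_action x i s = x + (s - x $ i) *\<^sub>R axis i 1"
  by (simp add: vec_eq_iff set_action_nth axis_def)

text \<open>
  Frechet differentiability makes the one-variable section differentiable, so that \<open>deriv\<close> in the
  definition of the partial derivative is a genuine derivative at every point of the section.
\<close>

lemma own_cost_deriv: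
  fixes g :: "real^'n::finite \<Rightarrow> real"
  assumes "C1_function g"
  shows "((\<lambda>s. g (set_action x i s)) has_real_derivative partial_deriv i g (set_action x i s)) (at s)"
proof -
  obtain g' where g': "\<And>x. (g has_derivative blinfun_apply (g' x)) (at x)"
    using assms unfolding C1_function_def by blast
  have "((\<lambda>s. x + (s - x $ i) *\<^sub>R axis i 1) has_derivative (\<lambda>h. h *\<^sub>R axis i (1::real))) (at s)"
    by (auto intro!: derivative_eq_intros)
  then have "((\<lambda>s. set_action x i s) has_derivative (\<lambda>h. h *\<^sub>R axis i 1)) (at s)"
    by (simp add: set_action_eq_axis)
  from has_derivative_compose[OF this g']
  have "((\<lambda>s. g (set_action x i s)) has_real_derivative
      blinfun_apply (g' (set_action x i s)) (axis i 1)) (at s)"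
    by (simp add: has_field_derivative_def blinfun.scaleR_right mult_commute_abs)
  then have "(\<lambda>s. g (set_action x i s)) differentiable at s"
    using real_differentiable_def by blast
  then show ?thesis
    by (simp add: partial_deriv_def set_action_nth DERIV_deriv_iff_real_differentiable)
qed

text \<open>
  At an equilibrium each section has a minimum.  Conversely, at a zero of the pseudogradient,
  monotonicity between \<open>x\<close> and a unilateral deviation says that the section decreases before
  \<open>x $ i\<close> and increases after it.
\<close>

lemma nash_equilibrium_iff_pseudogradient_zero:
  fixes f :: "'n::finite \<Rightarrow> real^'n \<Rightarrow> real"
  assumes f: "\<And>i. C1_function (f i)"
    and mono: "\<And>x z. (x - z) \<bullet> (pseudogradient f x - pseudogradient f z) \<ge> 0"
  shows "nash_equilibrium f x \<longleftrightarrow> pseudogradient f x = 0"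
proof
  assume nash: "nash_equilibrium f x"
  have "partial_deriv i (f i) x = 0" for i
  proof (rule DERIV_local_min[of "\<lambda>s. f i (set_action x i s)" _ "x $ i" 1])
    show "((\<lambda>s. f i (set_action x i s)) has_real_derivative partial_deriv i (f i) x) (at (x $ i))"
      using own_cost_deriv[OF f, of i x i "x $ i"] by simp
  qed (use nash in \<open>auto simp: nash_equilibrium_def\<close>)
  then show "pseudogradient f x = 0" by (simp add: pseudogradient_def vec_eq_iff)
next
  assume zero: "pseudogradient f x = 0"
  have "f i x \<le> f i (set_action x i s)" for i s
  proof -
    define g where "g r = f i (set_action x i r)" for r
    define g' where "g' r = partial_deriv i (f i) (set_action x i r)" for r
    have g': "(g has_real_derivative g' r) (at r)" for r
      unfolding g_def g'_def by (rule own_cost_deriv[OF f])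
    \<comment> \<open>Testing monotonicity on a unilateral deviation gives the sign of the derivative.\<close>
    have sgn: "(r - x $ i) * g' r \<ge> 0" for r
    proof -
      have "(set_action x i r - x) \<bullet> pseudogradient f (set_action x i r) \<ge> 0"
        using mono[of "set_action x i r" x] zero by simp
      then show ?thesis
        by (simp add: set_action_eq_axis[of x i r, THEN arg_cong[where f = "\<lambda>v. v - x"]]
            inner_axis' pseudogradient_def g'_def)
    qed
    have cont: "continuous_on S g" for S
      using g' by (intro continuous_at_imp_continuous_on ballI DERIV_isCont)
    have "g (x $ i) \<le> g s"
    proof (cases "x $ i \<le> s")
      case True
      then show ?thesis
      proof (rule DERIV_nonneg_imp_increasing_open[OF _ _ cont])
        fix r assume "x $ i < r"
        then have "g' r \<ge> 0" using sgn[of r] by (simp add: zero_le_mult_iff)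
        then show "\<exists>y. (g has_real_derivative y) (at r) \<and> 0 \<le> y" using g' by blast
      qed
    next
      case False
      then have "s \<le> x $ i" by simp
      then show ?thesis
      proof (rule DERIV_nonpos_imp_decreasing_open[OF _ _ cont])
        fix r assume "r < x $ i"
        then have "g' r \<le> 0" using sgn[of r] by (simp add: zero_le_mult_iff)
        then show "\<exists>y. (g has_real_derivative y) (at r) \<and> y \<le> 0" using g' by blast
      qed
    qed
    then show ?thesis by (simp add: g_def)
  qed
  then show "nash_equilibrium f x" by (simp add: nash_equilibrium_def)
qed

text \<open>
  For \<open>\<gamma> = m / M\<^sup>2\<close> the map \<open>x \<mapsto> x - \<gamma> P x\<close> contracts squared distances by
  \<open>1 - 2 \<gamma> m + \<gamma>\<^sup>2 M\<^sup>2 = 1 - (m / M)\<^sup>2\<close>.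
\<close>

lemma strongly_monotone_unique_zero:
  fixes P :: "'a::euclidean_space \<Rightarrow> 'a"
  assumes "m > 0" and mono: "\<And>x z. (x - z) \<bullet> (P x - P z) \<ge> m * (norm (x - z))\<^sup>2"
    and lip: "L-lipschitz_on UNIV P"
  shows "\<exists>!x. P x = 0"
proof -
  \<comment> \<open>Enlarging the Lipschitz constant to at least \<open>m\<close> keeps \<open>q\<close> in \<open>{0..<1}\<close>.\<close>
  define M where "M = L + m"
  have L: "L \<ge> 0" using lip by (rule lipschitz_on_nonneg)
  have M: "M > 0" "m \<le> M" using L \<open>m > 0\<close> by (auto simp: M_def)
  define \<gamma> where "\<gamma> = m / M\<^sup>2"
  have \<gamma>: "\<gamma> > 0" using \<open>m > 0\<close> M by (simp add: \<gamma>_def)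
  define q where "q = 1 - (m / M)\<^sup>2"
  have q: "0 \<le> q" "q < 1"
    using \<open>m > 0\<close> M by (auto simp: q_def power_le_one_iff abs_le_square_iff divide_le_eq_1)
  have expand: "(norm (v - \<gamma> *\<^sub>R p))\<^sup>2 = (norm v)\<^sup>2 - 2 * \<gamma> * (v \<bullet> p) + \<gamma>\<^sup>2 * (norm p)\<^sup>2"
    for v p :: 'a
    unfolding power2_norm_eq_inner
    by (simp add: inner_diff_left inner_diff_right inner_commute power2_eq_square algebra_simps)
  have contr: "dist (x - \<gamma> *\<^sub>R P x) (z - \<gamma> *\<^sub>R P z) \<le> sqrt q * dist x z" for x z
  proof -
    let ?d = "x - z" and ?p = "P x - P z"
    have "norm ?p \<le> M * norm ?d"
      using lipschitz_on_normD[OF lip, of x z] mult_right_mono[of L M "norm ?d"] \<open>m > 0\<close>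
      by (simp add: M_def)
    then have "(norm ?p)\<^sup>2 \<le> (M * norm ?d)\<^sup>2" by (rule power_mono) simp
    then have p: "\<gamma>\<^sup>2 * (norm ?p)\<^sup>2 \<le> \<gamma>\<^sup>2 * (M * norm ?d)\<^sup>2" by (rule mult_left_mono) simp
    have "2 * \<gamma> * (?d \<bullet> ?p) \<ge> 2 * \<gamma> * (m * (norm ?d)\<^sup>2)"
      using mono[of x z] \<gamma> by (intro mult_left_mono) auto
    with p have "(norm ?d)\<^sup>2 - 2 * \<gamma> * (?d \<bullet> ?p) + \<gamma>\<^sup>2 * (norm ?p)\<^sup>2
        \<le> (norm ?d)\<^sup>2 - 2 * \<gamma> * (m * (norm ?d)\<^sup>2) + \<gamma>\<^sup>2 * (M * norm ?d)\<^sup>2"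
      by linarith
    also have "\<dots> = q * (norm ?d)\<^sup>2"
      using M by (simp add: q_def \<gamma>_def field_simps power2_eq_square)
    also have "(norm ?d)\<^sup>2 - 2 * \<gamma> * (?d \<bullet> ?p) + \<gamma>\<^sup>2 * (norm ?p)\<^sup>2 = (norm (?d - \<gamma> *\<^sub>R ?p))\<^sup>2"
      by (rule expand[symmetric])
    finally have "norm (?d - \<gamma> *\<^sub>R ?p) \<le> sqrt (q * (norm ?d)\<^sup>2)"
      by (rule real_le_rsqrt)
    moreover have "?d - \<gamma> *\<^sub>R ?p = (x - \<gamma> *\<^sub>R P x) - (z - \<gamma> *\<^sub>R P z)"
      by (simp add: algebra_simps)
    ultimately show ?thesis by (simp add: dist_norm real_sqrt_mult)
  qed
  have "\<exists>!x. x - \<gamma> *\<^sub>R P x = x"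
    by (rule banach_fix_type[of "sqrt q"]) (use q contr in auto)
  then show ?thesis using \<gamma> by auto
qed

lemma lipschitz_on_vec_lambda:
  fixes g :: "'n::finite \<Rightarrow> 'a::metric_space \<Rightarrow> real"
  assumes "\<And>i. (L i)-lipschitz_on S (g i)"
  shows "(\<Sum>i\<in>UNIV. L i)-lipschitz_on S (\<lambda>x. \<chi> i. g i x)"
proof (rule lipschitz_onI)
  show "0 \<le> (\<Sum>i\<in>UNIV. L i)" using assms by (intro sum_nonneg lipschitz_on_nonneg)
  fix x y assume xy: "x \<in> S" "y \<in> S"
  have "dist (\<chi> i. g i x) (\<chi> i. g i y) \<le> (\<Sum>i\<in>UNIV. \<bar>((\<chi> i. g i x) - (\<chi> i. g i y)) $ i\<bar>)"
    unfolding dist_norm by (rule norm_le_l1_cart)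
  also have "\<dots> \<le> (\<Sum>i\<in>UNIV. L i * dist x y)"
    using lipschitz_onD[OF assms xy] by (intro sum_mono) (simp add: dist_real_def)
  finally show "dist (\<chi> i. g i x) (\<chi> i. g i y) \<le> (\<Sum>i\<in>UNIV. L i) * dist x y"
    by (simp add: sum_distrib_right)
qed

section \<open>Distributed seeking: exponential convergence of the reference\<close>

text \<open>
  For each column \<open>j\<close> this is the quadratic form of the graph Laplacian plus the diagonal
  matrix of the weights \<open>a i j\<close>, with which node \<open>i\<close> listens to node \<open>j\<close> directly.
\<close>

definition consensus_form :: "('n::finite \<Rightarrow> 'n \<Rightarrow> real) \<Rightarrow> real^'n^'n \<Rightarrow> real" where
  "consensus_form a e = (\<Sum>i\<in>UNIV. \<Sum>j\<in>UNIV.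
     e $ i $ j * ((\<Sum>l\<in>UNIV. a i l * (e $ i $ j - e $ l $ j)) + a i j * e $ i $ j))"

text \<open>
  Symmetrize the double sum by exchanging the summation indices.
\<close>

lemma laplacian_form_eq_sum_of_squares:
  fixes a :: "'n::finite \<Rightarrow> 'n \<Rightarrow> real"
  assumes "\<And>i l. a i l = a l i"
  shows "(\<Sum>i\<in>UNIV. v i * (\<Sum>l\<in>UNIV. a i l * (v i - v l)))
    = (\<Sum>i\<in>UNIV. \<Sum>l\<in>UNIV. a i l * (v i - v l)\<^sup>2) / 2"
proof -
  let ?s = "\<Sum>i\<in>UNIV. \<Sum>l\<in>UNIV. a i l * (v i - v l) * v i"
  have "?s = (\<Sum>i\<in>UNIV. \<Sum>l\<in>UNIV. a l i * (v l - v i) * v l)" by (rule sum.swap)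
  then have "?s + ?s = (\<Sum>i\<in>UNIV. \<Sum>l\<in>UNIV. a i l * (v i - v l) * v i + a l i * (v l - v i) * v l)"
    by (simp add: sum.distrib)
  also have "\<dots> = (\<Sum>i\<in>UNIV. \<Sum>l\<in>UNIV. a i l * (v i - v l)\<^sup>2)"
    by (intro sum.cong refl) (simp add: assms[of _ _] power2_eq_square algebra_simps)
  finally show ?thesis by (simp add: sum_distrib_left mult_ac)
qed

lemma consensus_form_eq_sum_of_squares:
  fixes a :: "'n::finite \<Rightarrow> 'n \<Rightarrow> real"
  assumes "\<And>i l. a i l = a l i"
  shows "consensus_form a e = (\<Sum>j\<in>UNIV. (\<Sum>i\<in>UNIV. \<Sum>l\<in>UNIV. a i l * (e $ i $ j - e $ l $ j)\<^sup>2) / 2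
     + (\<Sum>i\<in>UNIV. a i j * (e $ i $ j)\<^sup>2))"
proof -
  have "consensus_form a e = (\<Sum>j\<in>UNIV. \<Sum>i\<in>UNIV.
      e $ i $ j * (\<Sum>l\<in>UNIV. a i l * (e $ i $ j - e $ l $ j)) + a i j * (e $ i $ j)\<^sup>2)"
    unfolding consensus_form_def
    by (subst sum.swap) (simp add: distrib_left power2_eq_square mult_ac)
  then show ?thesis
    by (simp add: sum.distrib laplacian_form_eq_sum_of_squares[OF assms, of "\<lambda>i. e $ i $ _"])
qed

text \<open>
  If the sum of squares vanishes, then each column is constant along edges, hence constant by
  connectedness.  With at least two nodes, \<open>j\<close> has a neighbour, at which the diagonal part forces
  the constant to be \<open>0\<close>.
\<close>

lemma consensus_form_pos:
  fixes a :: "'n::finite \<Rightarrow> 'n \<Rightarrow> real"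
  assumes players: "CARD('n) \<ge> 2" and adj: "adjacency_matrix E a"
    and und: "undirected_graph E a" and conn: "connected_graph E" and "e \<noteq> 0"
  shows "consensus_form a e > 0"
proof (rule ccontr)
  assume neg: "\<not> ?thesis"
  have sym: "a i l = a l i" for i l using und by (auto simp: undirected_graph_def)
  have edge: "a i l > 0" if "(l, i) \<in> E" for i l using adj that by (auto simp: adjacency_matrix_def)
  have nn: "a i l \<ge> 0" for i l
    using adj by (cases "(l, i) \<in> E") (auto simp: adjacency_matrix_def less_imp_le)
  let ?A = "\<lambda>j. \<Sum>i\<in>UNIV. \<Sum>l\<in>UNIV. a i l * (e $ i $ j - e $ l $ j)\<^sup>2"
  let ?B = "\<lambda>j. \<Sum>i\<in>UNIV. a i j * (e $ i $ j)\<^sup>2"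
  have A: "?A j \<ge> 0" and B: "?B j \<ge> 0" for j by (intro sum_nonneg mult_nonneg_nonneg nn zero_le_power2)+
  have AB_nn: "0 \<le> ?A j / 2 + ?B j" for j using A[of j] B[of j] by linarith
  have "(\<Sum>j\<in>UNIV. ?A j / 2 + ?B j) \<le> 0"
    using neg consensus_form_eq_sum_of_squares[of a e, OF sym] by linarith
  moreover have "?A j / 2 + ?B j \<le> (\<Sum>j\<in>UNIV. ?A j / 2 + ?B j)" for j
    by (rule member_le_sum[of j UNIV "\<lambda>j. ?A j / 2 + ?B j"]) (simp_all only: AB_nn UNIV_I finite_code)
  ultimately have AB: "?A j / 2 + ?B j = 0" for j
    using AB_nn[of j] by (meson antisym order_trans)
  have A0: "?A j = 0" and B0: "?B j = 0" for j using AB[of j] A[of j] B[of j] by linarith+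
  have agree: "e $ i $ j = e $ l $ j" if "(l, i) \<in> E" for i l j
  proof -
    have "(\<Sum>l\<in>UNIV. a i l * (e $ i $ j - e $ l $ j)\<^sup>2) = 0"
      using A0[of j] sum_nonneg_eq_0_iff[of UNIV "\<lambda>i. \<Sum>l\<in>UNIV. a i l * (e $ i $ j - e $ l $ j)\<^sup>2"]
      by (simp add: sum_nonneg nn)
    then have "a i l * (e $ i $ j - e $ l $ j)\<^sup>2 = 0"
      using sum_nonneg_eq_0_iff[of UNIV "\<lambda>l. a i l * (e $ i $ j - e $ l $ j)\<^sup>2"] nn by simp
    then show ?thesis using edge[OF that] by simp
  qed
  have agree': "e $ i $ j = e $ l $ j" for i l j
  proof (cases "l = i")
    case False
    then have "(l, i) \<in> E\<^sup>+" using conn by (auto simp: connected_graph_def)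
    then show ?thesis by (induction rule: trancl_induct) (auto simp: agree)
  qed simp
  have "e $ i $ j = 0" for i j
  proof -
    obtain i0 where "i0 \<noteq> j" 
    proof -
      have "UNIV \<noteq> {j}" using players card_1_singleton_iff[of "UNIV :: 'n set"] by auto
      then show ?thesis using that by auto
    qed
    then have "(i0, j) \<in> E\<^sup>+" using conn by (auto simp: connected_graph_def)
    then obtain l where "(l, j) \<in> E" by (meson tranclE)
    then have "a l j > 0" using edge sym by metis
    moreover have "a l j * (e $ l $ j)\<^sup>2 = 0"
      using B0[of j] sum_nonneg_eq_0_iff[of UNIV "\<lambda>i. a i j * (e $ i $ j)\<^sup>2"] nn by simp
    ultimately show ?thesis using agree'[of i j l] by simp
  qed
  then show False using \<open>e \<noteq> 0\<close> by (simp add: vec_eq_iff)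
qed

text \<open>
  The form is quadratic, so its minimum on the compact unit sphere is the constant.
\<close>

lemma consensus_form_coercive:
  fixes a :: "'n::finite \<Rightarrow> 'n \<Rightarrow> real"
  assumes "\<And>e. e \<noteq> 0 \<Longrightarrow> consensus_form a e > 0"
  obtains \<mu> where "\<mu> > 0" "\<And>e. consensus_form a e \<ge> \<mu> * (norm e)\<^sup>2"
proof -
  have "continuous_on (sphere 0 1) (consensus_form a)"
    unfolding consensus_form_def[abs_def] by (intro continuous_intros)
  moreover have "sphere (0 :: real^'n^'n) 1 \<noteq> {}"
    using sphere_eq_empty[of "0 :: real^'n^'n" 1] by auto
  ultimately obtain e0 where e0: "e0 \<in> sphere 0 1"
      "\<And>e. e \<in> sphere 0 1 \<Longrightarrow> consensus_form a e0 \<le> consensus_form a e"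
    using continuous_attains_inf[OF compact_sphere] by metis
  have scale: "consensus_form a (c *\<^sub>R e) = c\<^sup>2 * consensus_form a e" for c e
  proof -
    have "c * x * ((\<Sum>l\<in>UNIV. w l * (c * x - c * y l)) + u * (c * x))
      = c\<^sup>2 * (x * ((\<Sum>l\<in>UNIV. w l * (x - y l)) + u * x))" for x u :: real and w y :: "'n \<Rightarrow> real"
    proof -
      have "(\<Sum>l\<in>UNIV. w l * (c * x - c * y l)) = c * (\<Sum>l\<in>UNIV. w l * (x - y l))"
        by (simp add: sum_distrib_left algebra_simps)
      then show ?thesis by (simp add: power2_eq_square algebra_simps)
    qed
    then show ?thesis
      unfolding consensus_form_def sum_distrib_left[of "c\<^sup>2"] vector_scaleR_component real_scaleR_def
      by (intro sum.cong refl)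
  qed
  show thesis
  proof
    have "e0 \<noteq> 0" using e0(1) by auto
    then show "consensus_form a e0 > 0" by (rule assms)
    fix e :: "real^'n^'n"
    show "consensus_form a e \<ge> consensus_form a e0 * (norm e)\<^sup>2"
    proof (cases "e = 0")
      case True
      then show ?thesis by (simp add: consensus_form_def)
    next
      case False
      then have "consensus_form a e0 \<le> consensus_form a ((1 / norm e) *\<^sub>R e)"
        by (intro e0(2)) simp
      then show ?thesis using False by (simp add: scale field_simps)
    qed
  qed
qed

text \<open>
  The autonomous subsystem of references \<open>y\<close> and estimates \<open>z\<close>, for a general family \<open>p\<close> in place of
  the partial derivatives of the costs.
\<close>

definition seeking_solution_on where
  "seeking_solution_on S p a \<delta> y z \<longleftrightarrow> (\<forall>t\<in>S. \<forall>i.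
     ((\<lambda>s. y s $ i) has_real_derivative - p i (z t $ i)) (at t within S) \<and>
     (\<forall>j. ((\<lambda>s. z s $ i $ j) has_real_derivative
        - \<delta> i j * ((\<Sum>l\<in>UNIV. a i l * (z t $ i $ j - z t $ l $ j))
                  + a i j * (z t $ i $ j - y t $ j))) (at t within S)))"

lemma norm_vec_squared: "(norm (v :: real^'n::finite))\<^sup>2 = (\<Sum>j\<in>UNIV. (v $ j)\<^sup>2)"
  unfolding power2_norm_eq_inner by (simp add: inner_vec_def power2_eq_square)

lemma norm_matrix_squared:
  "(norm (e :: real^'n::finite^'m::finite))\<^sup>2 = (\<Sum>i\<in>UNIV. \<Sum>j\<in>UNIV. (e $ i $ j)\<^sup>2)"
  unfolding power2_norm_eq_inner by (simp add: inner_vec_def power2_eq_square)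

text \<open>
  Dividing by \<open>\<delta>b\<close> makes the consensus part of the derivative exactly \<open>- \<delta> * consensus_form\<close>, so no
  interaction between the weights and the Laplacian has to be controlled.
\<close>

definition seeking_energy where
  "seeking_energy \<delta>b xs y z =
     ((\<Sum>j\<in>UNIV. (y $ j - xs $ j)\<^sup>2) + (\<Sum>i\<in>UNIV. \<Sum>j\<in>UNIV. (z $ i $ j - y $ j)\<^sup>2 / \<delta>b i j)) / 2"

text \<open>
  The derivative of the energy along the flow, with the right-hand sides of the equations inserted.
\<close>

definition seeking_energy_rate where
  "seeking_energy_rate \<delta>b xs p a \<delta> y z =
      (\<Sum>j\<in>UNIV. (y $ j - xs $ j) * - p j (z $ j)) +
      (\<Sum>i\<in>UNIV. \<Sum>j\<in>UNIV. (z $ i $ j - y $ j) / \<delta>b i j *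
         (- (\<delta> * \<delta>b i j) * ((\<Sum>l\<in>UNIV. a i l * (z $ i $ j - z $ l $ j)) + a i j * (z $ i $ j - y $ j))
          - (- p j (z $ j))))"

context
  fixes p :: "'n::finite \<Rightarrow> real^'n \<Rightarrow> real" and l :: "'n \<Rightarrow> real"
  assumes lip: "\<And>i. (l i)-lipschitz_on UNIV (p i)"
begin

text \<open>
  Player \<open>j\<close> evaluates its derivative at its own estimate \<open>z $ j\<close>, whose distance to \<open>y\<close> is the norm of
  one row of \<open>z - (\<chi> i. y)\<close>.
\<close>

lemma estimated_gradient_error:
  "norm ((\<chi> j. p j (z $ j)) - (\<chi> j. p j y)) \<le> (\<Sum>i\<in>UNIV. l i) * norm (z - (\<chi> i. y))"
proof -
  have "\<bar>p j (z $ j) - p j y\<bar> \<le> l j * norm (z - (\<chi> i. y))" for j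
  proof -
    have "\<bar>p j (z $ j) - p j y\<bar> \<le> l j * norm (z $ j - y)"
      using lipschitz_on_normD[OF lip, of "z $ j" y j] by simp
    also have "\<dots> \<le> l j * norm (z - (\<chi> i. y))"
      using Finite_Cartesian_Product.norm_nth_le[of "z - (\<chi> i. y)" j] lipschitz_on_nonneg[OF lip]
      by (intro mult_left_mono) auto
    finally show ?thesis .
  qed
  then show ?thesis
    by (intro order_trans[OF norm_le_l1_cart]) (simp add: sum_distrib_right sum_mono)
qed

context
  fixes xs :: "real^'n"
  assumes zero: "\<And>i. p i xs = 0"
begin

lemma true_gradient_bound: "norm (\<chi> j. p j y) \<le> (\<Sum>i\<in>UNIV. l i) * norm (y - xs)"
proof -
  have "\<bar>p j y\<bar> \<le> l j * norm (y - xs)" for j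
    using lipschitz_on_normD[OF lip, of y xs j] zero by simp
  then show ?thesis
    by (intro order_trans[OF norm_le_l1_cart]) (simp add: sum_distrib_right sum_mono)
qed

lemma estimated_gradient_bound:
  "\<bar>p j (z $ j)\<bar> \<le> (\<Sum>i\<in>UNIV. l i) * (norm (z - (\<chi> i. y)) + norm (y - xs))"
proof -
  have "\<bar>p j (z $ j)\<bar> \<le> norm (\<chi> j. p j (z $ j))"
    using component_le_norm_cart[of "\<chi> j. p j (z $ j)" j] by simp
  also have "\<dots> \<le> norm ((\<chi> j. p j (z $ j)) - (\<chi> j. p j y)) + norm (\<chi> j. p j y)"
    using norm_triangle_ineq[of "(\<chi> j. p j (z $ j)) - (\<chi> j. p j y)" "\<chi> j. p j y"] by simp
  finally show ?thesis
    using estimated_gradient_error[of z y] true_gradient_bound[of y] by (simp add: distrib_left)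
qed

context
  fixes m :: real and \<delta>b :: "'n \<Rightarrow> 'n \<Rightarrow> real"
  assumes m: "m > 0"
    and mono: "\<And>x z. (x - z) \<bullet> ((\<chi> i. p i x) - (\<chi> i. p i z)) \<ge> m * (norm (x - z))\<^sup>2"
    and db: "\<And>i j. \<delta>b i j > 0"
begin

text \<open>
  With \<open>r = norm (y - xs)\<close> and \<open>s = norm e\<close>, \<open>e = z - (\<chi> i. y)\<close>, the rate is at most
  \<open>- m r\<^sup>2 + K r s + D L s\<^sup>2 - \<delta> \<mu> s\<^sup>2\<close>.  Young's inequality moves \<open>K r s\<close> into half of the first term
  and a multiple of \<open>s\<^sup>2\<close>, and \<open>\<delta>s\<close> is the value of \<open>\<delta>\<close> from which \<open>\<delta> \<mu> s\<^sup>2\<close> exceeds all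
  terms in \<open>s\<^sup>2\<close> by at least \<open>s\<^sup>2\<close>.
\<close>

lemma seeking_energy_dissipation:
  assumes "\<mu> > 0" and coercive: "\<And>e. consensus_form a e \<ge> \<mu> * (norm e)\<^sup>2"
  obtains \<delta>s where "\<delta>s > 0" and "\<And>\<delta> y z. \<delta> > \<delta>s \<Longrightarrow>
      seeking_energy_rate \<delta>b xs p a \<delta> y z
      \<le> - (m / 2 * (norm (y - xs))\<^sup>2 + (norm (z - (\<chi> i. y)))\<^sup>2)"
proof -
  define L where "L = (\<Sum>i\<in>UNIV. l i)"
  define D where "D = (\<Sum>i\<in>UNIV. \<Sum>j\<in>UNIV. 1 / \<delta>b i j)"
  define K where "K = L * (1 + D)"
  have L: "L \<ge> 0" unfolding L_def using lipschitz_on_nonneg[OF lip] by (intro sum_nonneg)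
  have D: "D \<ge> 0" unfolding D_def using db by (intro sum_nonneg) (simp add: less_imp_le)
  define \<delta>s where "\<delta>s = (K\<^sup>2 / (2 * m) + D * L + 1) / \<mu>"
  have "\<delta>s > 0" unfolding \<delta>s_def using m L D \<open>\<mu> > 0\<close> by (intro divide_pos_pos add_nonneg_pos add_nonneg_nonneg) auto
  have "seeking_energy_rate \<delta>b xs p a \<delta> y z
      \<le> - (m / 2 * (norm (y - xs))\<^sup>2 + (norm (z - (\<chi> i. y)))\<^sup>2)" if "\<delta> > \<delta>s" for \<delta> y z
  proof -
    define e where "e = z - (\<chi> i. y)"
    define r where "r = norm (y - xs)"
    define s where "s = norm e"
    have nn: "r \<ge> 0" "s \<ge> 0" by (auto simp: r_def s_def)
    have e: "e $ i $ j = z $ i $ j - y $ j" for i j by (simp add: e_def)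
    let ?G = "\<chi> j. p j (z $ j)" and ?P = "\<lambda>x. \<chi> j. p j x"
    have "(\<Sum>j\<in>UNIV. (y $ j - xs $ j) * - p j (z $ j)) = - ((y - xs) \<bullet> ?G)"
      by (simp add: inner_vec_def sum_negf)
    also have "\<dots> = - ((y - xs) \<bullet> (?P y - ?P xs)) - (y - xs) \<bullet> (?G - ?P y)"
    proof -
      have "?P xs = 0" by (simp add: zero vec_eq_iff)
      then show ?thesis by (simp add: inner_diff_right)
    qed
    also have "\<dots> \<le> - (m * r\<^sup>2) + L * (r * s)"
    proof -
      have "- ((y - xs) \<bullet> (?G - ?P y)) \<le> r * norm (?G - ?P y)"
        using Cauchy_Schwarz_ineq2[of "y - xs" "?G - ?P y"] by (simp add: r_def abs_le_iff)
      also have "\<dots> \<le> r * (L * s)"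
        using estimated_gradient_error[of z y] nn unfolding L_def s_def e_def
        by (intro mult_left_mono) auto
      finally show ?thesis using mono[of y xs] by (simp add: r_def mult_ac)
    qed
    finally have descent: "(\<Sum>j\<in>UNIV. (y $ j - xs $ j) * - p j (z $ j)) \<le> - (m * r\<^sup>2) + L * (r * s)" .
    have "(z $ i $ j - y $ j) / \<delta>b i j *
         (- (\<delta> * \<delta>b i j) * ((\<Sum>l\<in>UNIV. a i l * (z $ i $ j - z $ l $ j)) + a i j * (z $ i $ j - y $ j))
          - (- p j (z $ j)))
       = - \<delta> * (e $ i $ j * ((\<Sum>l\<in>UNIV. a i l * (e $ i $ j - e $ l $ j)) + a i j * e $ i $ j))
         + e $ i $ j / \<delta>b i j * p j (z $ j)" for i j
    proof -
      have "u / d * (- (\<delta> * d) * X - (- q)) = - \<delta> * (u * X) + u / d * q" if "d > 0" for u d X q :: real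
        using that by (simp add: field_simps)
      from this[OF db] show ?thesis by (simp add: e)
    qed
    then have "(\<Sum>i\<in>UNIV. \<Sum>j\<in>UNIV. (z $ i $ j - y $ j) / \<delta>b i j *
         (- (\<delta> * \<delta>b i j) * ((\<Sum>l\<in>UNIV. a i l * (z $ i $ j - z $ l $ j)) + a i j * (z $ i $ j - y $ j))
          - (- p j (z $ j))))
       = - \<delta> * consensus_form a e + (\<Sum>i\<in>UNIV. \<Sum>j\<in>UNIV. e $ i $ j / \<delta>b i j * p j (z $ j))"
      by (simp only: sum.distrib sum_distrib_left[symmetric] consensus_form_def)
    also have "\<dots> \<le> - (\<delta> * \<mu> * s\<^sup>2) + D * (L * (s * s + r * s))"
    proof (rule add_mono)
      have "\<delta> > 0" using that \<open>\<delta>s > 0\<close> by linarith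
      then have "\<delta> * (\<mu> * s\<^sup>2) \<le> \<delta> * consensus_form a e"
        unfolding s_def by (intro mult_left_mono coercive) auto
      then show "- \<delta> * consensus_form a e \<le> - (\<delta> * \<mu> * s\<^sup>2)" by simp
      have "e $ i $ j / \<delta>b i j * p j (z $ j) \<le> 1 / \<delta>b i j * (L * (s * s + r * s))" for i j
      proof -
        have "\<bar>e $ i $ j\<bar> \<le> s"
          using component_le_norm_cart[of "e $ i" j] Finite_Cartesian_Product.norm_nth_le[of e i]
          unfolding s_def by linarith
        moreover have "\<bar>p j (z $ j)\<bar> \<le> L * (s + r)"
          using estimated_gradient_bound[of j z y] by (simp add: L_def s_def r_def e_def)
        ultimately have "\<bar>e $ i $ j\<bar> * \<bar>p j (z $ j)\<bar> \<le> s * (L * (s + r))"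
          using nn by (intro mult_mono) auto
        then have "e $ i $ j * p j (z $ j) \<le> L * (s * s + r * s)"
          by (simp add: abs_mult[symmetric] algebra_simps abs_le_iff)
        from mult_left_mono[OF this, of "1 / \<delta>b i j"] show ?thesis
          using db[of i j] by simp
      qed
      then show "(\<Sum>i\<in>UNIV. \<Sum>j\<in>UNIV. e $ i $ j / \<delta>b i j * p j (z $ j)) \<le> D * (L * (s * s + r * s))"
        unfolding D_def sum_distrib_right by (intro sum_mono)
    qed
    finally have consensus: "(\<Sum>i\<in>UNIV. \<Sum>j\<in>UNIV. (z $ i $ j - y $ j) / \<delta>b i j *
         (- (\<delta> * \<delta>b i j) * ((\<Sum>l\<in>UNIV. a i l * (z $ i $ j - z $ l $ j)) + a i j * (z $ i $ j - y $ j))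
          - (- p j (z $ j)))) \<le> - (\<delta> * \<mu> * s\<^sup>2) + D * (L * (s * s + r * s))" .
    have "K * (r * s) \<le> m / 2 * r\<^sup>2 + K\<^sup>2 / (2 * m) * s\<^sup>2"
    proof -
      have "0 \<le> (m * r - K * s)\<^sup>2 / (2 * m)" using m by simp
      also have "\<dots> = m / 2 * r\<^sup>2 + K\<^sup>2 / (2 * m) * s\<^sup>2 - K * (r * s)"
        using m by (simp add: field_simps power2_eq_square)
      finally show ?thesis by simp
    qed
    moreover have "(K\<^sup>2 / (2 * m) + D * L + 1) * s\<^sup>2 \<le> \<delta> * \<mu> * s\<^sup>2"
      using that \<open>\<mu> > 0\<close> unfolding \<delta>s_def by (intro mult_right_mono) (simp_all add: field_simps)
    moreover have "L * (r * s) + D * (L * (s * s + r * s)) = K * (r * s) + D * L * s\<^sup>2"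
      by (simp add: K_def power2_eq_square algebra_simps)
    ultimately show ?thesis
      using descent consensus unfolding seeking_energy_rate_def r_def[symmetric] e_def[symmetric] s_def[symmetric]
        distrib_right minus_add_distrib by linarith
  qed
  then show thesis using that \<open>\<delta>s > 0\<close> by blast
qed

text \<open>
  The energy \<open>V\<close> is comparable to \<open>r\<^sup>2 + s\<^sup>2\<close>, so the dissipation gives \<open>V' \<le> - c V\<close>.  The gradients
  are bounded by \<open>L * (r + s)\<close> and inherit the decay of \<open>sqrt V\<close>.  The threshold \<open>\<delta>s\<close>, the rate and
  the factor \<open>A\<close> depend neither on the initial values nor on the length of the time interval.
\<close>

lemma seeking_exponential_convergence:
  assumes "\<mu> > 0" and coercive: "\<And>e. consensus_form a e \<ge> \<mu> * (norm e)\<^sup>2"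
  obtains \<delta>s c A where "\<delta>s > 0" "c > 0"
    and "\<And>\<delta> T y z t. \<delta> > \<delta>s \<Longrightarrow> seeking_solution_on {0..T} p a (\<lambda>i j. \<delta> * \<delta>b i j) y z \<Longrightarrow> t \<in> {0..T} \<Longrightarrow>
      norm (y t - xs) \<le> A * sqrt (seeking_energy \<delta>b xs (y 0) (z 0)) * exp (- (c * t)) \<and>
      norm (z t - (\<chi> i. y t)) \<le> A * sqrt (seeking_energy \<delta>b xs (y 0) (z 0)) * exp (- (c * t)) \<and>
      (\<forall>i. \<bar>p i (z t $ i)\<bar> \<le> A * sqrt (seeking_energy \<delta>b xs (y 0) (z 0)) * exp (- (c * t)))"
proof -
  obtain \<delta>s where \<delta>s: "\<delta>s > 0" and diss: "\<And>\<delta> y z. \<delta> > \<delta>s \<Longrightarrow>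
      seeking_energy_rate \<delta>b xs p a \<delta> y z
      \<le> - (m / 2 * (norm (y - xs))\<^sup>2 + (norm (z - (\<chi> i. y)))\<^sup>2)"
    by (rule seeking_energy_dissipation[OF assms]) (rule that)
  define L where "L = (\<Sum>i\<in>UNIV. l i)"
  have L: "L \<ge> 0" unfolding L_def using lipschitz_on_nonneg[OF lip] by (intro sum_nonneg)
  define D where "D = (\<Sum>i\<in>UNIV. \<Sum>j\<in>UNIV. 1 / \<delta>b i j)"
  have D_ge: "1 / \<delta>b i j \<le> D" for i j
  proof -
    have "1 / \<delta>b i j \<le> (\<Sum>j\<in>UNIV. 1 / \<delta>b i j)"
      using db by (intro member_le_sum) (auto simp: less_imp_le)
    also have "\<dots> \<le> D" unfolding D_def
      using db by (intro member_le_sum[of i UNIV "\<lambda>i. \<Sum>j\<in>UNIV. 1 / \<delta>b i j"] sum_nonneg) (auto simp: less_imp_le)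
    finally show ?thesis .
  qed
  define \<Delta> where "\<Delta> = (\<Sum>i\<in>UNIV. \<Sum>j\<in>UNIV. \<delta>b i j)"
  have \<Delta>_ge: "\<delta>b i j \<le> \<Delta>" for i j
  proof -
    have "\<delta>b i j \<le> (\<Sum>j\<in>UNIV. \<delta>b i j)"
      using db by (intro member_le_sum) (auto simp: less_imp_le)
    also have "\<dots> \<le> \<Delta>" unfolding \<Delta>_def
      using db by (intro member_le_sum[of i UNIV "\<lambda>i. \<Sum>j\<in>UNIV. \<delta>b i j"] sum_nonneg) (auto simp: less_imp_le)
    finally show ?thesis .
  qed
  have D: "D > 0" using D_ge db by (meson less_le_trans zero_less_divide_1_iff)
  have \<Delta>: "\<Delta> > 0" using \<Delta>_ge db by (meson less_le_trans)
  have energy: "seeking_energy \<delta>b xs y z = ((norm (y - xs))\<^sup>2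
      + (\<Sum>i\<in>UNIV. \<Sum>j\<in>UNIV. ((z - (\<chi> i. y)) $ i $ j)\<^sup>2 / \<delta>b i j)) / 2" for y z
    by (simp add: seeking_energy_def norm_vec_squared)
  have weighted_le: "(\<Sum>i\<in>UNIV. \<Sum>j\<in>UNIV. (e $ i $ j)\<^sup>2 / \<delta>b i j) \<le> D * (norm e)\<^sup>2" for e :: "real^'n^'n"
    unfolding norm_matrix_squared sum_distrib_left
    using mult_right_mono[OF D_ge zero_le_power2] by (intro sum_mono) simp
  have weighted_ge: "(norm e)\<^sup>2 \<le> \<Delta> * (\<Sum>i\<in>UNIV. \<Sum>j\<in>UNIV. (e $ i $ j)\<^sup>2 / \<delta>b i j)" for e :: "real^'n^'n"
    unfolding norm_matrix_squared sum_distrib_left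
  proof (intro sum_mono)
    fix i j
    show "(e $ i $ j)\<^sup>2 \<le> \<Delta> * ((e $ i $ j)\<^sup>2 / \<delta>b i j)"
      using mult_right_mono[OF \<Delta>_ge[of i j] zero_le_power2[of "e $ i $ j"]] db[of i j]
      by (simp add: field_simps)
  qed
  \<comment> \<open>The two arguments of the minimum come from comparing \<open>c V\<close> with \<open>m / 2 * r\<^sup>2\<close> and with \<open>s\<^sup>2\<close>.\<close>
  define c where "c = min m (2 / D)"
  have c: "c > 0" "c \<le> m" "c * D \<le> 2"
    using m D by (auto simp: c_def min_def field_simps)
  define A0 where "A0 = sqrt 2 + sqrt (2 * \<Delta>)"
  define A where "A = A0 + L * (A0 + A0)"
  have A0: "A0 \<ge> 0" unfolding A0_def using \<Delta> by simp
  then have A: "A \<ge> 0" "A0 \<le> A" "L * (A0 + A0) \<le> A" unfolding A_def using L by auto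
  show thesis
  proof (rule that[OF \<delta>s, of "c / 2" A])
    show "c / 2 > 0" using c by simp
    fix \<delta> T y z t
    assume \<delta>: "\<delta> > \<delta>s" and sol: "seeking_solution_on {0..T} p a (\<lambda>i j. \<delta> * \<delta>b i j) y z"
      and t: "t \<in> {0..T}"
    define V where "V t = seeking_energy \<delta>b xs (y t) (z t)" for t
    define V' where "V' t = seeking_energy_rate \<delta>b xs p a \<delta> (y t) (z t)" for t
    have V': "(V has_real_derivative V' s) (at s within {0..T})" if s: "s \<in> {0..T}" for s
    proof -
      note d = sol[unfolded seeking_solution_on_def, rule_format, OF s]
      have dy: "((\<lambda>s. (y s $ j - xs $ j)\<^sup>2) has_real_derivative 2 * ((y s $ j - xs $ j) * - p j (z s $ j)))
         (at s within {0..T})" for j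
        by (rule DERIV_cong[OF DERIV_power[OF DERIV_diff[OF conjunct1[OF d] DERIV_const], where n = 2]]) simp
      have dz: "((\<lambda>s. (z s $ i $ j - y s $ j)\<^sup>2 / \<delta>b i j) has_real_derivative
          2 * ((z s $ i $ j - y s $ j) / \<delta>b i j *
         (- (\<delta> * \<delta>b i j) * ((\<Sum>l\<in>UNIV. a i l * (z s $ i $ j - z s $ l $ j)) + a i j * (z s $ i $ j - y s $ j))
          - (- p j (z s $ j))))) (at s within {0..T})" for i j
        by (rule DERIV_cong[OF DERIV_cdivide[OF DERIV_power[OF DERIV_diff[OF
              conjunct2[OF d, rule_format] conjunct1[OF d]], where n = 2]]]) simp
      have halve: "((\<Sum>j\<in>UNIV. 2 * u j) + (\<Sum>i\<in>UNIV. \<Sum>j\<in>UNIV. 2 * v i j)) / 2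
          = (\<Sum>j\<in>UNIV. u j) + (\<Sum>i\<in>UNIV. \<Sum>j\<in>UNIV. v i j)" for u :: "'n \<Rightarrow> real" and v :: "'n \<Rightarrow> 'n \<Rightarrow> real"
        by (simp add: sum_distrib_left[symmetric] add_divide_distrib)
      show ?thesis
        unfolding V_def[abs_def] seeking_energy_def
        by (rule DERIV_cong[OF DERIV_cdivide[OF DERIV_add[OF DERIV_sum[OF dy] DERIV_sum[OF DERIV_sum[OF dz]]]]])
           (unfold V'_def seeking_energy_rate_def, rule halve)
    qed
    have "V t \<le> V 0 * exp (- c * t)"
    proof (rule exponential_decay[OF V' _ t])
      fix s assume "s \<in> {0..T}"
      let ?r2 = "(norm (y s - xs))\<^sup>2" and ?s2 = "(norm (z s - (\<chi> i. y s)))\<^sup>2"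
      have "c * V s = c * ?r2 / 2 + c * (\<Sum>i\<in>UNIV. \<Sum>j\<in>UNIV. ((z s - (\<chi> i. y s)) $ i $ j)\<^sup>2 / \<delta>b i j) / 2"
        unfolding V_def energy by (simp add: distrib_left add_divide_distrib)
      also have "\<dots> \<le> c * ?r2 / 2 + c * (D * ?s2) / 2"
        by (rule add_left_mono[OF divide_right_mono[OF mult_left_mono[OF weighted_le]]]) (use c in auto)
      also have "\<dots> \<le> m * ?r2 / 2 + 2 * ?s2 / 2"
        unfolding mult.assoc[symmetric] using c by (intro add_mono divide_right_mono mult_right_mono) auto
      finally show "V' s \<le> - c * V s"
        using diss[OF \<delta>, of "y s" "z s"] unfolding V'_def by simp
    qed
    then have Vt: "sqrt (V t) \<le> sqrt (V 0) * exp (- (c / 2 * t))"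
    proof -
      have "sqrt (V t) \<le> sqrt (V 0 * exp (- c * t))" 
        using \<open>V t \<le> _\<close> by (rule real_sqrt_le_mono)
      also have "exp (- c * t) = (exp (- (c / 2 * t)))\<^sup>2" by (simp flip: exp_double)
      finally show ?thesis by (simp add: real_sqrt_mult)
    qed
    have nn: "0 \<le> (\<Sum>i\<in>UNIV. \<Sum>j\<in>UNIV. (e $ i $ j)\<^sup>2 / \<delta>b i j)" for e :: "real^'n^'n"
      using db by (intro sum_nonneg divide_nonneg_nonneg) (auto simp: less_imp_le)
    have "(norm (y t - xs))\<^sup>2 \<le> 2 * V t"
      unfolding V_def energy using nn[of "z t - (\<chi> i. y t)"] by simp
    then have "norm (y t - xs) \<le> sqrt (2 * V t)" by (rule real_le_rsqrt)
    then have r: "norm (y t - xs) \<le> sqrt 2 * sqrt (V t)" by (simp add: real_sqrt_mult)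
    have "(norm (z t - (\<chi> i. y t)))\<^sup>2 \<le> 2 * \<Delta> * V t"
    proof -
      have "\<Delta> * (\<Sum>i\<in>UNIV. \<Sum>j\<in>UNIV. ((z t - (\<chi> i. y t)) $ i $ j)\<^sup>2 / \<delta>b i j) \<le> \<Delta> * (2 * V t)"
        unfolding V_def energy using \<Delta> by (intro mult_left_mono) auto
      then show ?thesis using weighted_ge[of "z t - (\<chi> i. y t)"] by simp
    qed
    then have "norm (z t - (\<chi> i. y t)) \<le> sqrt (2 * \<Delta> * V t)" by (rule real_le_rsqrt)
    then have s: "norm (z t - (\<chi> i. y t)) \<le> sqrt (2 * \<Delta>) * sqrt (V t)" by (simp add: real_sqrt_mult)
    have Vnn: "0 \<le> V t" for t 
      unfolding V_def energy by (intro divide_nonneg_nonneg add_nonneg_nonneg nn zero_le_power2) simp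
    define w where "w = sqrt (V 0) * exp (- (c / 2 * t))"
    have w: "w \<ge> 0" "sqrt (V t) \<le> w" using Vt Vnn by (auto simp: w_def)
    have r': "norm (y t - xs) \<le> A0 * w"
      by (rule order_trans[OF r mult_mono]) (use w Vnn A0 \<Delta> in \<open>auto simp: A0_def\<close>)
    have s': "norm (z t - (\<chi> i. y t)) \<le> A0 * w"
      by (rule order_trans[OF s mult_mono]) (use w Vnn A0 \<Delta> in \<open>auto simp: A0_def\<close>)
    have "\<bar>p i (z t $ i)\<bar> \<le> A * w" for i
    proof -
      have "\<bar>p i (z t $ i)\<bar> \<le> L * (A0 * w + A0 * w)"
        using estimated_gradient_bound[of i "z t" "y t"] mult_left_mono[OF add_mono[OF s' r'] L]
        unfolding L_def by linarith
      also have "\<dots> = L * (A0 + A0) * w" by (simp add: algebra_simps)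
      also have "\<dots> \<le> A * w" using A w by (intro mult_right_mono) auto
      finally show ?thesis .
    qed
    moreover have "A0 * w \<le> A * w" using A w by (intro mult_right_mono) auto
    ultimately show "norm (y t - xs) \<le> A * sqrt (seeking_energy \<delta>b xs (y 0) (z 0)) * exp (- (c / 2 * t)) \<and>
      norm (z t - (\<chi> i. y t)) \<le> A * sqrt (seeking_energy \<delta>b xs (y 0) (z 0)) * exp (- (c / 2 * t)) \<and>
      (\<forall>i. \<bar>p i (z t $ i)\<bar> \<le> A * sqrt (seeking_energy \<delta>b xs (y 0) (z 0)) * exp (- (c / 2 * t)))"
      using r' s' unfolding w_def V_def mult.assoc by (meson order_trans)
  qed
qed

end

end

end

section \<open>Global solutions from a priori bounds\<close>

text \<open>
  Picard iteration at once on the whole half line.  In the unknown \<open>g t = exp (- lam * t) v t\<close> the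
  integral operator maps bounded continuous functions to such functions, and for \<open>lam\<close> larger
  than \<open>2 L\<close> it is a contraction of the supremum norm with factor \<open>1 / 2\<close>.
\<close>

lemma lipschitz_ode_global_solution:
  fixes F :: "'a::euclidean_space \<Rightarrow> 'a"
  assumes lip: "L-lipschitz_on UNIV F"
  obtains v where "v 0 = v0"
    and "\<And>t. t \<ge> 0 \<Longrightarrow> (v has_vector_derivative F (v t)) (at t within {0..})"
proof -
  have L0: "L \<ge> 0" using lip by (rule lipschitz_on_nonneg)
  define lam where "lam = 2 * L + 1"
  have lam: "lam > 0" "L / lam \<le> 1/2" using L0 by (auto simp: lam_def field_simps)
  have contF: "continuous_on S F" for S
    using lipschitz_on_continuous_on[OF lip] continuous_on_subset by blast
  \<comment> \<open>Bounded continuous functions are total, so negative times are folded onto time \<open>0\<close>.\<close>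
  define u :: "real \<Rightarrow> real" where "u t = max 0 t" for t
  have u0: "u t \<ge> 0" for t by (simp add: u_def)
  have contu: "continuous_on S u" for S unfolding u_def by (intro continuous_intros)
  define h where "h g s = F (exp (lam * s) *\<^sub>R apply_bcontfun g s)" for g :: "real \<Rightarrow>\<^sub>C 'a" and s
  have conth: "continuous_on S (h g)" for g S
    unfolding h_def by (intro continuous_on_compose2[OF contF[of UNIV]] continuous_intros) auto
  have inth: "h g integrable_on {0..r}" for g r
    by (intro integrable_continuous_real conth)
  define T where "T g t = exp (- lam * u t) *\<^sub>R (v0 + integral {0..u t} (h g))"
    for g :: "real \<Rightarrow>\<^sub>C 'a" and t
  have int_exp: "((\<lambda>s. exp (lam * s)) has_integral (exp (lam * r) - 1) / lam) {0..r}" if "r \<ge> 0" for r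
  proof -
    have "((\<lambda>s. exp (lam * s)) has_integral exp (lam * r) / lam - exp (lam * 0) / lam) {0..r}"
      using that lam
      by (intro fundamental_theorem_of_calculus)
         (auto intro!: derivative_eq_intros simp flip: has_real_derivative_iff_has_vector_derivative)
    then show ?thesis by (simp add: diff_divide_distrib)
  qed
  have weight: "exp (- lam * r) * ((exp (lam * r) - 1) / lam) \<le> 1 / lam" for r
    using lam by (simp add: field_simps exp_minus)
  have dist_h: "norm (h g s - h g' s) \<le> L * dist g g' * exp (lam * s)" for g g' s
  proof -
    have "norm (h g s - h g' s) \<le> L * norm (exp (lam * s) *\<^sub>R (apply_bcontfun g s - apply_bcontfun g' s))"
      using lipschitz_on_normD[OF lip, of "exp (lam * s) *\<^sub>R apply_bcontfun g s"
          "exp (lam * s) *\<^sub>R apply_bcontfun g' s"]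
      by (simp add: h_def algebra_simps)
    also have "\<dots> = L * (exp (lam * s) * dist (apply_bcontfun g s) (apply_bcontfun g' s))"
      by (simp add: dist_norm)
    also have "\<dots> \<le> L * (exp (lam * s) * dist g g')"
      using dist_bounded L0 by (intro mult_left_mono) auto
    finally show ?thesis by (simp add: mult_ac)
  qed
  have diff_T: "norm (exp (- lam * u t) *\<^sub>R (integral {0..u t} (h g) - integral {0..u t} (h g')))
      \<le> L / lam * dist g g'" for g g' t
  proof -
    have "norm (integral {0..u t} (h g) - integral {0..u t} (h g'))
        = norm (integral {0..u t} (\<lambda>s. h g s - h g' s))"
      by (simp add: integral_diff inth)
    also have "\<dots> \<le> integral {0..u t} (\<lambda>s. L * dist g g' * exp (lam * s))"
      using dist_h
      by (intro integral_norm_bound_integral integrable_diff inth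
                integrable_continuous_real continuous_intros) auto
    also have "\<dots> = L * dist g g' * ((exp (lam * u t) - 1) / lam)"
      using integral_unique[OF int_exp[OF u0[of t]]] by simp
    finally have "norm (integral {0..u t} (h g) - integral {0..u t} (h g'))
        \<le> L * dist g g' * ((exp (lam * u t) - 1) / lam)" .
    then have "exp (- lam * u t) * norm (integral {0..u t} (h g) - integral {0..u t} (h g'))
        \<le> exp (- lam * u t) * (L * dist g g' * ((exp (lam * u t) - 1) / lam))"
      by (rule mult_left_mono) simp
    then have "norm (exp (- lam * u t) *\<^sub>R (integral {0..u t} (h g) - integral {0..u t} (h g')))
        \<le> exp (- lam * u t) * (L * dist g g' * ((exp (lam * u t) - 1) / lam))"
      by simp
    also have "\<dots> = L * dist g g' * (exp (- lam * u t) * ((exp (lam * u t) - 1) / lam))"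
      by (simp only: mult_ac)
    also have "\<dots> \<le> L * dist g g' * (1 / lam)"
      using L0 by (intro mult_left_mono weight) auto
    finally show ?thesis by simp
  qed
  have contT: "continuous_on UNIV (T g)" for g
  proof -
    have "continuous_on {0..} (\<lambda>r. integral {0..r} (h g))"
    proof (rule continuous_at_imp_continuous_on, intro ballI, goal_cases)
      case (1 r)
      have "continuous_on {-1..r+1} (\<lambda>r. integral {0..r} (h g))"
      proof -
        have "continuous_on {0..r+1} (\<lambda>r. integral {0..r} (h g))"
          by (intro indefinite_integral_continuous_1 inth)
        moreover have "continuous_on {-1..0} (\<lambda>r. integral {0..r} (h g))"
        proof -
          have "integral {0..s} (h g) = 0" if "s \<in> {-1..0}" for s
            using that by (cases "s = 0") auto
          then show ?thesis
            using continuous_on_cong[of "{-1..0}" "{-1..0}" "\<lambda>r. integral {0..r} (h g)" "\<lambda>_. 0"] by auto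
        qed
        ultimately have "continuous_on ({-1..0} \<union> {0..r+1}) (\<lambda>r. integral {0..r} (h g))"
          by (intro continuous_on_closed_Un) auto
        moreover have "{-1..0} \<union> {0..r+1} = {-1..r+1}" using 1 by auto
        ultimately show ?thesis by simp
      qed
      then show ?case
        using 1 by (intro continuous_on_interior[of "{-1..r+1}"]) auto
    qed
    then have "continuous_on UNIV (\<lambda>t. integral {0..u t} (h g))"
      by (rule continuous_on_compose2[OF _ contu]) (auto simp: u0)
    then show ?thesis unfolding T_def by (intro continuous_intros contu)
  qed
  \<comment> \<open>The field may be unbounded, but comparison with \<open>g = 0\<close> and the factor \<open>exp (- lam * t)\<close> keep
    \<open>T g\<close> bounded.\<close>
  have T_bcont: "T g \<in> bcontfun" for g
  proof (rule bcontfun_normI[OF contT])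
    fix t
    have "norm (integral {0..u t} (h 0)) \<le> integral {0..u t} (\<lambda>s. norm (F 0))"
      by (intro integral_norm_bound_integral inth) (auto simp: h_def)
    then have h0: "norm (integral {0..u t} (h 0)) \<le> u t * norm (F 0)"
      using u0[of t] by simp
    have ub: "exp (- lam * u t) * u t \<le> 1 / lam"
    proof -
      have "lam * u t \<le> exp (lam * u t)" using exp_ge_add_one_self[of "lam * u t"] by linarith
      then show ?thesis using lam by (simp add: exp_minus field_simps)
    qed
    have "T g t = exp (- lam * u t) *\<^sub>R v0 + exp (- lam * u t) *\<^sub>R integral {0..u t} (h 0)
        + exp (- lam * u t) *\<^sub>R (integral {0..u t} (h g) - integral {0..u t} (h 0))"
      by (simp add: T_def algebra_simps)
    also have "norm \<dots> \<le> norm (exp (- lam * u t) *\<^sub>R v0)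
        + norm (exp (- lam * u t) *\<^sub>R integral {0..u t} (h 0))
        + norm (exp (- lam * u t) *\<^sub>R (integral {0..u t} (h g) - integral {0..u t} (h 0)))"
      by (intro norm_triangle_le add_mono order_refl) 
    also have "\<dots> \<le> norm v0 + norm (F 0) / lam + L / lam * dist g 0"
    proof (intro add_mono diff_T)
      have "exp (- lam * u t) \<le> 1" using lam u0[of t] by simp
      then show "norm (exp (- lam * u t) *\<^sub>R v0) \<le> norm v0"
        by (simp add: mult_left_le_one_le)
      have "norm (exp (- lam * u t) *\<^sub>R integral {0..u t} (h 0)) \<le> exp (- lam * u t) * (u t * norm (F 0))"
        using h0 by simp
      also have "\<dots> = (exp (- lam * u t) * u t) * norm (F 0)" by simp
      also have "\<dots> \<le> 1 / lam * norm (F 0)" by (intro mult_right_mono ub) auto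
      finally show "norm (exp (- lam * u t) *\<^sub>R integral {0..u t} (h 0)) \<le> norm (F 0) / lam" by simp
    qed
    finally show "norm (T g t) \<le> norm v0 + norm (F 0) / lam + L / lam * dist g 0" .
  qed
  define TB where "TB g = Bcontfun (T g)" for g
  have TB: "apply_bcontfun (TB g) = T g" for g
    unfolding TB_def by (simp add: Bcontfun_inverse T_bcont)
  have "dist (TB g) (TB g') \<le> 1/2 * dist g g'" for g g'
  proof (rule dist_bound)
    fix t
    have "dist (T g t) (T g' t)
        = norm (exp (- lam * u t) *\<^sub>R (integral {0..u t} (h g) - integral {0..u t} (h g')))"
      by (simp add: dist_norm T_def algebra_simps)
    also have "\<dots> \<le> L / lam * dist g g'" by (rule diff_T)
    also have "\<dots> \<le> 1/2 * dist g g'" by (intro mult_right_mono lam) auto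
    finally show "dist (apply_bcontfun (TB g) t) (apply_bcontfun (TB g') t) \<le> 1/2 * dist g g'"
      by (simp add: TB)
  qed
  then have "\<exists>!g. TB g = g"
    by (intro banach_fix_type[of "1/2"]) auto
  then obtain g where g: "TB g = g" by blast
  define v where "v t = v0 + integral {0..u t} (h g)" for t
  have gv: "exp (lam * s) *\<^sub>R apply_bcontfun g s = v s" if "s \<ge> 0" for s
  proof -
    have "apply_bcontfun g s = exp (- lam * s) *\<^sub>R v s"
      using TB[of g] g that by (simp add: T_def v_def u_def)
    then show ?thesis by (simp flip: exp_add)
  qed
  show thesis
  proof
    show "v 0 = v0" by (simp add: v_def u_def)
    fix t :: real assume t: "t \<ge> 0"
    have "((\<lambda>r. v0 + integral {0..r} (h g)) has_vector_derivative 0 + h g t) (at t within {0..t+1})"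
      using t by (intro has_vector_derivative_add has_vector_derivative_const
          integral_has_vector_derivative conth) auto
    then have "((\<lambda>r. v0 + integral {0..r} (h g)) has_vector_derivative h g t) (at t within {0..t+1})"
      by (simp only: add_0_left)
    then have "(v has_vector_derivative h g t) (at t within {0..t+1})"
      by (rule has_vector_derivative_transform[rotated 2]) (use t in \<open>simp_all add: v_def u_def\<close>)
    moreover have "at t within {0..t+1} = at t within {0..}"
      by (rule at_within_nhd[where S = "{..<t+1}"]) auto
    moreover have "h g t = F (v t)"
      unfolding h_def gv[OF t] by (rule refl)
    ultimately show "(v has_vector_derivative F (v t)) (at t within {0..})"
      by simp
  qed
qed

text \<open>
  Composing the field with the nearest-point projection onto a ball of radius \<open>R > B\<close> makes it globally
  Lipschitz.  Until its first exit from the ball, a solution of the new equation solves the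
  original one and therefore obeys the bound \<open>B < R\<close>, so there is no exit.
\<close>

lemma global_solution_of_a_priori_bound:
  fixes F :: "'a::euclidean_space \<Rightarrow> 'a"
  assumes lip: "\<And>R. \<exists>L. L-lipschitz_on (cball 0 R) F"
    and bound: "\<And>v T t. v 0 = v0 \<Longrightarrow> 
       (\<And>t. t \<in> {0..T} \<Longrightarrow> (v has_vector_derivative F (v t)) (at t within {0..T})) \<Longrightarrow>
       t \<in> {0..T} \<Longrightarrow> norm (v t) \<le> B"
  obtains v where "v 0 = v0"
    and "\<And>t. t \<ge> 0 \<Longrightarrow> (v has_vector_derivative F (v t)) (at t within {0..})"
proof -
  define R where "R = \<bar>B\<bar> + norm v0 + 1"
  have R: "R > 0" "B < R" "norm v0 \<le> R" unfolding R_def using norm_ge_zero[of v0] by linarith+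
  define p where "p = closest_point (cball (0::'a) R)"
  have p_lip: "1-lipschitz_on UNIV p"
    unfolding p_def using R by (intro lipschitz_onI) (auto intro: closest_point_lipschitz)
  have p_in: "p v \<in> cball 0 R" for v
    unfolding p_def using R by (intro closest_point_in_set) auto
  have p_id: "p v = v" if "norm v \<le> R" for v
    unfolding p_def using that by (intro closest_point_self) auto
  obtain L where L: "L-lipschitz_on (cball 0 R) F" using lip by blast
  have "(L * 1)-lipschitz_on UNIV (\<lambda>v. F (p v))"
    by (rule lipschitz_on_compose2[OF p_lip lipschitz_on_subset[OF L]]) (use p_in in auto)
  then obtain v where v0: "v 0 = v0"
    and v': "\<And>t. t \<ge> 0 \<Longrightarrow> (v has_vector_derivative F (p (v t))) (at t within {0..})"
    using lipschitz_ode_global_solution by blast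
  have contv: "continuous_on {0..} v"
    using v' by (meson atLeast_iff continuous_on_eq_continuous_within has_vector_derivative_continuous)
  have inside: "norm (v t) \<le> R" if "t \<ge> 0" for t
  proof (rule ccontr)
    assume out: "\<not> ?thesis"
    have contn: "continuous_on {0..s} (\<lambda>s. norm (v s))" for s
      using contv by (intro continuous_intros) (auto intro: continuous_on_subset)
    have hit: "\<exists>r\<in>{0..s}. norm (v r) = R" if "s \<ge> 0" "norm (v s) \<ge> R" for s
      using IVT'[of "\<lambda>s. norm (v s)" 0 R s] that contn[of s] R v0 by auto
    define S where "S = {0..t} \<inter> (\<lambda>s. norm (v s)) -` {R}"
    have "closed S"
      unfolding S_def by (intro continuous_closed_preimage contn) auto
    moreover have "S \<noteq> {}" using hit[OF that] out by (auto simp: S_def)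
    moreover have bdd: "bdd_below S" unfolding S_def by (intro bdd_belowI[of _ 0]) auto
    ultimately have exit: "Inf S \<in> S" by (metis closed_contains_Inf)
    have before: "norm (v s) \<le> R" if s: "s \<in> {0..Inf S}" for s
    proof (rule ccontr)
      assume "\<not> ?thesis"
      then obtain r where r: "r \<in> {0..s}" "norm (v r) = R" using hit[of s] s by auto
      then have "r \<in> S" using s exit by (auto simp: S_def)
      then have "Inf S \<le> r" using bdd by (intro cInf_lower)
      then have "s = r" using r s by auto
      with r \<open>\<not> norm (v s) \<le> R\<close> show False by simp
    qed
    have "norm (v (Inf S)) \<le> B"
    proof (rule bound[of v, OF v0])
      fix s assume s: "s \<in> {0..Inf S}"
      then show "(v has_vector_derivative F (v s)) (at s within {0..Inf S})"
        using v'[of s] p_id[OF before[OF s]]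
        by (auto intro: has_vector_derivative_within_subset)
    qed (use exit in \<open>auto simp: S_def\<close>)
    then show False using exit R by (auto simp: S_def)
  qed
  show thesis
  proof
    show "v 0 = v0" by (rule v0)
    show "(v has_vector_derivative F (v t)) (at t within {0..})" if "t \<ge> 0" for t
      using v'[OF that] p_id[OF inside[OF that]] by simp
  qed
qed

section \<open>Functions that are Lipschitz on every ball\<close>

text \<open>
  In finite dimension this is the same as being locally Lipschitz; stated for balls, it is closed
  under products and compositions by elementary estimates.
\<close>

definition lipschitz_on_balls :: "('a::real_normed_vector \<Rightarrow> 'b::metric_space) \<Rightarrow> bool" where
  "lipschitz_on_balls g \<longleftrightarrow> (\<forall>R. \<exists>L. L-lipschitz_on (cball 0 R) g)"

lemma lipschitz_on_balls_of_global: "L-lipschitz_on UNIV g \<Longrightarrow> lipschitz_on_balls g"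
  unfolding lipschitz_on_balls_def by (meson lipschitz_on_subset top_greatest)

lemma lipschitz_on_balls_const: "lipschitz_on_balls (\<lambda>x. c)"
  by (rule lipschitz_on_balls_of_global[OF lipschitz_on_constant])

lemma lipschitz_on_balls_linear: "bounded_linear g \<Longrightarrow> lipschitz_on_balls g"
  by (metis bounded_linear.lipschitz_boundE lipschitz_on_balls_of_global)

lemma lipschitz_on_ball_norm_le:
  fixes g :: "'a::real_normed_vector \<Rightarrow> 'b::real_normed_vector"
  assumes "L-lipschitz_on (cball 0 R) g" "v \<in> cball 0 R"
  shows "norm (g v) \<le> norm (g 0) + L * \<bar>R\<bar>"
proof -
  have "0 \<in> cball (0::'a) R" using assms(2) by (auto intro: order_trans[OF norm_ge_zero])
  then have "norm (g v - g 0) \<le> L * norm (v - 0)"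
    using lipschitz_on_normD[OF assms] by blast
  also have "\<dots> \<le> L * \<bar>R\<bar>"
    using assms lipschitz_on_nonneg by (intro mult_left_mono) force+
  finally show ?thesis using norm_triangle_sub[of "g v" "g 0"] by linarith
qed

text \<open>
  The inner function maps a ball into some larger ball, on which the outer one is Lipschitz.
\<close>

lemma lipschitz_on_balls_compose:
  fixes g :: "'a::real_normed_vector \<Rightarrow> 'b::real_normed_vector"
  assumes h: "lipschitz_on_balls h" and g: "lipschitz_on_balls g"
  shows "lipschitz_on_balls (\<lambda>v. h (g v))"
  unfolding lipschitz_on_balls_def
proof
  fix R
  obtain L where L: "L-lipschitz_on (cball 0 R) g" using g unfolding lipschitz_on_balls_def by blast
  define R' where "R' = norm (g 0) + L * \<bar>R\<bar>"
  obtain M where M: "M-lipschitz_on (cball 0 R') h" using h unfolding lipschitz_on_balls_def by blast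
  have "(M * L)-lipschitz_on (cball 0 R) (\<lambda>v. h (g v))"
    by (rule lipschitz_on_compose2[OF L lipschitz_on_subset[OF M]])
       (use lipschitz_on_ball_norm_le[OF L] in \<open>auto simp: R'_def\<close>)
  then show "\<exists>L. L-lipschitz_on (cball 0 R) (\<lambda>v. h (g v))" by blast
qed

lemma lipschitz_on_balls_add:
  fixes g h :: "'a::real_normed_vector \<Rightarrow> 'b::real_normed_vector"
  shows "lipschitz_on_balls g \<Longrightarrow> lipschitz_on_balls h \<Longrightarrow> lipschitz_on_balls (\<lambda>v. g v + h v)"
  unfolding lipschitz_on_balls_def by (blast intro: lipschitz_on_add)

lemma lipschitz_on_balls_diff:
  fixes g h :: "'a::real_normed_vector \<Rightarrow> 'b::real_normed_vector"
  shows "lipschitz_on_balls g \<Longrightarrow> lipschitz_on_balls h \<Longrightarrow> lipschitz_on_balls (\<lambda>v. g v - h v)"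
  unfolding lipschitz_on_balls_def by (blast intro: lipschitz_on_diff)

lemma lipschitz_on_balls_minus:
  fixes g :: "'a::real_normed_vector \<Rightarrow> 'b::real_normed_vector"
  shows "lipschitz_on_balls g \<Longrightarrow> lipschitz_on_balls (\<lambda>v. - g v)"
  unfolding lipschitz_on_balls_def by (blast intro: lipschitz_on_minus)

text \<open>
  Write \<open>g v h v - g w h w = g v (h v - h w) + h w (g v - g w)\<close> and bound both factors on the ball.
\<close>

lemma lipschitz_on_balls_mult:
  fixes g h :: "'a::real_normed_vector \<Rightarrow> real"
  assumes "lipschitz_on_balls g" "lipschitz_on_balls h"
  shows "lipschitz_on_balls (\<lambda>v. g v * h v)"
  unfolding lipschitz_on_balls_def
proof
  fix R
  obtain L M where L: "L-lipschitz_on (cball 0 R) g" and M: "M-lipschitz_on (cball 0 R) h"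
    using assms unfolding lipschitz_on_balls_def by metis
  define G where "G = norm (g 0) + L * \<bar>R\<bar>"
  define H where "H = norm (h 0) + M * \<bar>R\<bar>"
  have nn: "0 \<le> L" "0 \<le> M" using L M lipschitz_on_nonneg by blast+
  then have GH: "0 \<le> G" "0 \<le> H" by (auto simp: G_def H_def)
  have "(G * M + H * L)-lipschitz_on (cball 0 R) (\<lambda>v. g v * h v)"
  proof (rule lipschitz_onI)
    fix v w :: 'a assume vw: "v \<in> cball 0 R" "w \<in> cball 0 R"
    have "\<bar>g v\<bar> \<le> G" "\<bar>h w\<bar> \<le> H"
      using lipschitz_on_ball_norm_le[OF L vw(1)] lipschitz_on_ball_norm_le[OF M vw(2)]
      by (auto simp: G_def H_def)
    moreover have "\<bar>g v - g w\<bar> \<le> L * dist v w" "\<bar>h v - h w\<bar> \<le> M * dist v w"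
      using lipschitz_onD[OF L vw] lipschitz_onD[OF M vw] by (auto simp: dist_real_def)
    ultimately have "\<bar>g v\<bar> * \<bar>h v - h w\<bar> + \<bar>h w\<bar> * \<bar>g v - g w\<bar> \<le> G * (M * dist v w) + H * (L * dist v w)"
      using GH by (intro add_mono mult_mono) auto
    moreover have "g v * h v - g w * h w = g v * (h v - h w) + h w * (g v - g w)"
      by (simp add: algebra_simps)
    then have "\<bar>g v * h v - g w * h w\<bar> \<le> \<bar>g v\<bar> * \<bar>h v - h w\<bar> + \<bar>h w\<bar> * \<bar>g v - g w\<bar>"
      by (metis abs_mult abs_triangle_ineq)
    ultimately show "dist (g v * h v) (g w * h w) \<le> (G * M + H * L) * dist v w"
      by (simp add: dist_real_def algebra_simps)
  qed (use nn GH in auto)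
  then show "\<exists>L. L-lipschitz_on (cball 0 R) (\<lambda>v. g v * h v)" by blast
qed

lemma lipschitz_on_balls_Pair:
  assumes "lipschitz_on_balls g" "lipschitz_on_balls h"
  shows "lipschitz_on_balls (\<lambda>v. (g v, h v))"
  using assms unfolding lipschitz_on_balls_def by (blast intro: lipschitz_on_Pair)

lemma lipschitz_on_balls_sum:
  fixes g :: "'i \<Rightarrow> 'a::real_normed_vector \<Rightarrow> 'b::real_normed_vector"
  assumes "\<And>i. i \<in> I \<Longrightarrow> lipschitz_on_balls (g i)"
  shows "lipschitz_on_balls (\<lambda>v. \<Sum>i\<in>I. g i v)"
  using assms
  by (induction I rule: infinite_finite_induct) (simp_all add: lipschitz_on_balls_const lipschitz_on_balls_add)

lemma lipschitz_on_balls_vec_lambda: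
  fixes g :: "'n::finite \<Rightarrow> 'a::real_normed_vector \<Rightarrow> 'b::real_normed_vector"
  assumes "\<And>i. lipschitz_on_balls (g i)"
  shows "lipschitz_on_balls (\<lambda>v. \<chi> i. g i v)"
proof -
  have "bounded_linear (\<lambda>w. axis i w :: 'b^'n)" for i
    by (rule bounded_linear_intro[of _ 1])
       (auto simp: axis_def vec_eq_iff norm_vec_def L2_set_def if_distrib[of norm] if_distrib[of "\<lambda>x. x\<^sup>2"] cong: if_cong)
  then have "lipschitz_on_balls (\<lambda>v. axis i (g i v) :: 'b^'n)" for i
    by (rule lipschitz_on_balls_compose[OF lipschitz_on_balls_linear assms])
  then have "lipschitz_on_balls (\<lambda>v. \<Sum>i\<in>UNIV. axis i (g i v) :: 'b^'n)"
    by (rule lipschitz_on_balls_sum)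
  moreover have "(\<Sum>i\<in>UNIV. axis i (g i v)) = (\<chi> i. g i v)" for v
    by (simp add: vec_eq_iff axis_def)
  ultimately show ?thesis by simp
qed

lemma lipschitz_on_balls_C1:
  fixes g :: "real \<Rightarrow> real"
  assumes "g C1_differentiable_on UNIV"
  shows "lipschitz_on_balls g"
  unfolding lipschitz_on_balls_def
proof
  fix R :: real
  obtain D where D: "\<And>x. (g has_real_derivative D x) (at x)" "continuous_on UNIV D"
    using assms unfolding C1_differentiable_on_def has_real_derivative_iff_has_vector_derivative by auto
  have "bounded (D ` cball 0 R)"
    using continuous_on_subset[OF D(2)] by (intro compact_imp_bounded compact_continuous_image) auto
  then obtain B where "\<forall>y\<in>D ` cball 0 R. norm y \<le> B" unfolding bounded_iff by blast
  then have B: "\<And>x. x \<in> cball 0 R \<Longrightarrow> \<bar>D x\<bar> \<le> B" by simp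
  have "\<bar>B\<bar>-lipschitz_on (cball 0 R) g"
  proof (rule bounded_derivative_imp_lipschitz)
    fix x :: real assume x: "x \<in> cball 0 R"
    show "(g has_derivative (*) (D x)) (at x within cball 0 R)"
      using D(1)[of x] by (auto simp: has_field_derivative_def intro: has_derivative_at_withinI)
    show "onorm ((*) (D x)) \<le> \<bar>B\<bar>"
      using B[OF x] by (intro onorm_le) (auto simp: abs_mult intro!: mult_right_mono)
  qed auto
  then show "\<exists>L. L-lipschitz_on (cball 0 R) g" by blast
qed

lemma lipschitz_on_balls_nussbaum: "lipschitz_on_balls nussbaum"
proof (rule lipschitz_on_balls_C1)
  have "(nussbaum has_real_derivative 2 * k * sin k + k\<^sup>2 * cos k) (at k)" for k
    unfolding nussbaum_def by (auto intro!: derivative_eq_intros)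
  then show "nussbaum C1_differentiable_on UNIV"
    unfolding C1_differentiable_on_def
    by (intro exI[of _ "\<lambda>k. 2 * k * sin k + k\<^sup>2 * cos k"])
       (auto simp: has_real_derivative_iff_has_vector_derivative intro!: continuous_intros)
qed

section \<open>The closed loop\<close>

type_synonym 'n state = "(real^'n) \<times> (real^'n) \<times> (real^'n) \<times> (real^'n) \<times> (real^'n^'n)"

text \<open>
  The right-hand side of the closed loop as one vector field, with the control law substituted, so
  that the existence theorem for autonomous equations applies.  The components of the state
  are \<open>x\<close>, \<open>k\<close>, \<open>\<theta>h\<close>, \<open>y\<close>, \<open>z\<close> in this order.
\<close>

definition closed_loop_field ::
  "('n::finite \<Rightarrow> real^'n \<Rightarrow> real) \<Rightarrow> ('n \<Rightarrow> real) \<Rightarrow> ('n \<Rightarrow> real) \<Rightarrow> ('n \<Rightarrow> real \<Rightarrow> real) \<Rightarrow>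
   ('n \<Rightarrow> 'n \<Rightarrow> real) \<Rightarrow> ('n \<Rightarrow> 'n \<Rightarrow> real) \<Rightarrow> 'n state \<Rightarrow> 'n state" where
  "closed_loop_field p b \<theta> \<phi> a \<delta> = (\<lambda>(x, k, h, y, z).
    (\<chi> i. b i * (nussbaum (k $ i) * (x $ i - y $ i + \<phi> i (x $ i) * h $ i)) + \<phi> i (x $ i) * \<theta> i,
     \<chi> i. (x $ i - y $ i) * (x $ i - y $ i + \<phi> i (x $ i) * h $ i),
     \<chi> i. \<phi> i (x $ i) * (x $ i - y $ i),
     \<chi> i. - p i (z $ i),
     \<chi> i j. - \<delta> i j * ((\<Sum>l\<in>UNIV. a i l * (z $ i $ j - z $ l $ j)) + a i j * (z $ i $ j - y $ j))))"

lemma lipschitz_on_balls_closed_loop_field: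
  fixes p :: "'n::finite \<Rightarrow> real^'n \<Rightarrow> real"
  assumes "\<And>i. \<phi> i C1_differentiable_on UNIV" and "\<And>i. (l i)-lipschitz_on UNIV (p i)"
  shows "lipschitz_on_balls (closed_loop_field p b \<theta> \<phi> a \<delta>)"
proof -
  have snd2: "bounded_linear (\<lambda>v :: 'n state. snd (snd v))"
    by (rule bounded_linear_compose[OF bounded_linear_snd bounded_linear_snd])
  have snd3: "bounded_linear (\<lambda>v :: 'n state. snd (snd (snd v)))"
    by (rule bounded_linear_compose[OF bounded_linear_snd snd2])
  have snd4: "bounded_linear (\<lambda>v :: 'n state. snd (snd (snd (snd v))))"
    by (rule bounded_linear_compose[OF bounded_linear_snd snd3])
  note nth = lipschitz_on_balls_linear[OF bounded_linear_compose[OF bounded_linear_vec_nth]]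
  note nth2 = lipschitz_on_balls_linear[OF bounded_linear_compose[OF bounded_linear_vec_nth
                bounded_linear_compose[OF bounded_linear_vec_nth]]]
  have x: "lipschitz_on_balls (\<lambda>v :: 'n state. fst v $ i)" for i
    by (rule nth[OF bounded_linear_fst])
  have k: "lipschitz_on_balls (\<lambda>v :: 'n state. fst (snd v) $ i)" for i
    by (rule nth[OF bounded_linear_compose[OF bounded_linear_fst bounded_linear_snd]])
  have h: "lipschitz_on_balls (\<lambda>v :: 'n state. fst (snd (snd v)) $ i)" for i
    by (rule nth[OF bounded_linear_compose[OF bounded_linear_fst snd2]])
  have y: "lipschitz_on_balls (\<lambda>v :: 'n state. fst (snd (snd (snd v))) $ i)" for i
    by (rule nth[OF bounded_linear_compose[OF bounded_linear_fst snd3]])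
  have z: "lipschitz_on_balls (\<lambda>v :: 'n state. snd (snd (snd (snd v))) $ i)" for i
    by (rule nth[OF snd4])
  have zz: "lipschitz_on_balls (\<lambda>v :: 'n state. snd (snd (snd (snd v))) $ i $ j)" for i j
    by (rule nth2[OF snd4])
  note arith = lipschitz_on_balls_add lipschitz_on_balls_diff lipschitz_on_balls_mult
    lipschitz_on_balls_const x k h y z zz
  have phi: "lipschitz_on_balls (\<lambda>v :: 'n state. \<phi> i (fst v $ i))" for i
    by (rule lipschitz_on_balls_compose[OF lipschitz_on_balls_C1[OF assms(1)] x])
  have nuss: "lipschitz_on_balls (\<lambda>v :: 'n state. nussbaum (fst (snd v) $ i))" for i
    by (rule lipschitz_on_balls_compose[OF lipschitz_on_balls_nussbaum k])
  have grad: "lipschitz_on_balls (\<lambda>v :: 'n state. p i (snd (snd (snd (snd v))) $ i))" for i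
    by (rule lipschitz_on_balls_compose[OF lipschitz_on_balls_of_global[OF assms(2)] z])
  show ?thesis
    unfolding closed_loop_field_def case_prod_beta
    by (intro lipschitz_on_balls_Pair lipschitz_on_balls_vec_lambda;
        intro lipschitz_on_balls_sum lipschitz_on_balls_minus arith phi nuss grad)
qed

text \<open>
  The cascade form of the closed loop: the seeking subsystem together with one tracking loop for
  each player, whose reference derivative is supplied by the seeking subsystem.
\<close>

definition loop_solution_on where
  "loop_solution_on S p b \<theta> \<phi> a \<delta> x k h y z \<longleftrightarrow> seeking_solution_on S p a \<delta> y z \<and>
     (\<forall>i. player_solution_on S (b i) (\<theta> i) (\<phi> i) (\<lambda>s. x s $ i) (\<lambda>s. k s $ i) (\<lambda>s. h s $ i)
            (\<lambda>s. y s $ i) (\<lambda>s. - p i (z s $ i)))"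

lemma closed_loop_solution_iff_loop_solution_on:
  "closed_loop_solution f b \<theta> \<phi> a \<delta> x k h y z \<longleftrightarrow>
     loop_solution_on {0..} (\<lambda>i. partial_deriv i (f i)) b \<theta> \<phi> a \<delta> x k h y z"
proof
  assume "closed_loop_solution f b \<theta> \<phi> a \<delta> x k h y z"
  then show "loop_solution_on {0..} (\<lambda>i. partial_deriv i (f i)) b \<theta> \<phi> a \<delta> x k h y z"
    unfolding closed_loop_solution_def loop_solution_on_def seeking_solution_on_def player_solution_on_def
  proof (elim exE, goal_cases)
    case (1 u)
    have d: "u t $ i = nussbaum (k t $ i) * (x t $ i - y t $ i + \<phi> i (x t $ i) * h t $ i)"
      "((\<lambda>s. x s $ i) has_real_derivative b i * u t $ i + \<phi> i (x t $ i) * \<theta> i) (at t within {0..})"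
      "((\<lambda>s. k s $ i) has_real_derivative
         (x t $ i - y t $ i) * (x t $ i - y t $ i + \<phi> i (x t $ i) * h t $ i)) (at t within {0..})"
      "((\<lambda>s. h s $ i) has_real_derivative \<phi> i (x t $ i) * (x t $ i - y t $ i)) (at t within {0..})"
      "((\<lambda>s. y s $ i) has_real_derivative - partial_deriv i (f i) (z t $ i)) (at t within {0..})"
      "((\<lambda>s. z s $ i $ j) has_real_derivative
         - \<delta> i j * ((\<Sum>l\<in>UNIV. a i l * (z t $ i $ j - z t $ l $ j))
                    + a i j * (z t $ i $ j - y t $ j))) (at t within {0..})" if "t \<in> {0..}" for t i j
      using 1[THEN spec, THEN mp, OF that[unfolded atLeast_iff], THEN spec, of i]
      by - ((elim conjE, assumption)+, elim conjE, erule spec)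
    show ?case
    proof (intro conjI allI ballI d)
      fix i and t :: real
      assume t: "t \<in> {0..}"
      show "((\<lambda>s. x s $ i) has_real_derivative
          b i * (nussbaum (k t $ i) * (x t $ i - y t $ i + \<phi> i (x t $ i) * h t $ i)) + \<phi> i (x t $ i) * \<theta> i)
          (at t within {0..})"
        using d(2)[OF t] by (simp only: d(1)[OF t])
    qed
  qed
next
  assume "loop_solution_on {0..} (\<lambda>i. partial_deriv i (f i)) b \<theta> \<phi> a \<delta> x k h y z"
  then show "closed_loop_solution f b \<theta> \<phi> a \<delta> x k h y z"
    unfolding closed_loop_solution_def loop_solution_on_def seeking_solution_on_def player_solution_on_def
    by (intro exI[of _ "\<lambda>t. \<chi> i. nussbaum (k t $ i) * (x t $ i - y t $ i + \<phi> i (x t $ i) * h t $ i)"])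
       (simp add: Ball_def)
qed

lemma loop_solution_on_subset:
  assumes "loop_solution_on S p b \<theta> \<phi> a \<delta> x k h y z" "T \<subseteq> S"
  shows "loop_solution_on T p b \<theta> \<phi> a \<delta> x k h y z"
  using assms unfolding loop_solution_on_def seeking_solution_on_def player_solution_on_def
  by (meson DERIV_subset subsetD)

lemma loop_solution_on_of_field:
  fixes v :: "real \<Rightarrow> 'n::finite state"
  assumes v: "\<And>t. t \<in> S \<Longrightarrow> (v has_vector_derivative closed_loop_field p b \<theta> \<phi> a \<delta> (v t)) (at t within S)"
  shows "loop_solution_on S p b \<theta> \<phi> a \<delta> (\<lambda>t. fst (v t)) (\<lambda>t. fst (snd (v t)))
     (\<lambda>t. fst (snd (snd (v t)))) (\<lambda>t. fst (snd (snd (snd (v t))))) (\<lambda>t. snd (snd (snd (snd (v t)))))"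
proof -
  note push = bounded_linear.has_vector_derivative
  have parts: "((\<lambda>t. fst (v t)) has_vector_derivative fst (closed_loop_field p b \<theta> \<phi> a \<delta> (v t))) (at t within S)"
    "((\<lambda>t. fst (snd (v t))) has_vector_derivative fst (snd (closed_loop_field p b \<theta> \<phi> a \<delta> (v t)))) (at t within S)"
    "((\<lambda>t. fst (snd (snd (v t)))) has_vector_derivative
        fst (snd (snd (closed_loop_field p b \<theta> \<phi> a \<delta> (v t))))) (at t within S)"
    "((\<lambda>t. fst (snd (snd (snd (v t))))) has_vector_derivative
        fst (snd (snd (snd (closed_loop_field p b \<theta> \<phi> a \<delta> (v t)))))) (at t within S)"
    "((\<lambda>t. snd (snd (snd (snd (v t))))) has_vector_derivative
        snd (snd (snd (snd (closed_loop_field p b \<theta> \<phi> a \<delta> (v t)))))) (at t within S)"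
    if t: "t \<in> S" for t
    by (intro push[OF bounded_linear_fst] push[OF bounded_linear_snd] v[OF t])+
  have nth: "((\<lambda>t. w t $ i) has_real_derivative w' $ i) (at t within S)"
    if "(w has_vector_derivative w') (at t within S)" for w :: "real \<Rightarrow> real^'n" and w' t i
    using push[OF bounded_linear_vec_nth that]
    by (simp add: has_real_derivative_iff_has_vector_derivative)
  have nth2: "((\<lambda>t. w t $ i $ j) has_real_derivative w' $ i $ j) (at t within S)"
    if "(w has_vector_derivative w') (at t within S)" for w :: "real \<Rightarrow> real^'n^'n" and w' t i j
    using push[OF bounded_linear_vec_nth push[OF bounded_linear_vec_nth that]]
    by (simp add: has_real_derivative_iff_has_vector_derivative)
  show ?thesis
    unfolding loop_solution_on_def seeking_solution_on_def player_solution_on_def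
  proof (intro conjI allI ballI)
    fix t i assume t: "t \<in> S"
    note d = nth[OF parts(1)[OF t], of i] nth[OF parts(2)[OF t], of i] nth[OF parts(3)[OF t], of i]
      nth[OF parts(4)[OF t], of i] nth2[OF parts(5)[OF t], of i]
    show "((\<lambda>s. fst (snd (snd (snd (v s)))) $ i) has_real_derivative - p i (snd (snd (snd (snd (v t)))) $ i)) (at t within S)"
      and "((\<lambda>s. fst (snd (snd (snd (v s)))) $ i) has_real_derivative - p i (snd (snd (snd (snd (v t)))) $ i)) (at t within S)"
      using d(4) by (simp_all add: closed_loop_field_def case_prod_beta)
    show "((\<lambda>s. fst (v s) $ i) has_real_derivative
        b i * (nussbaum (fst (snd (v t)) $ i) * (fst (v t) $ i - fst (snd (snd (snd (v t)))) $ i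
            + \<phi> i (fst (v t) $ i) * fst (snd (snd (v t))) $ i)) + \<phi> i (fst (v t) $ i) * \<theta> i) (at t within S)"
      using d(1) by (simp add: closed_loop_field_def case_prod_beta)
    show "((\<lambda>s. fst (snd (v s)) $ i) has_real_derivative
        (fst (v t) $ i - fst (snd (snd (snd (v t)))) $ i) * (fst (v t) $ i - fst (snd (snd (snd (v t)))) $ i
            + \<phi> i (fst (v t) $ i) * fst (snd (snd (v t))) $ i)) (at t within S)"
      using d(2) by (simp add: closed_loop_field_def case_prod_beta)
    show "((\<lambda>s. fst (snd (snd (v s))) $ i) has_real_derivative
        \<phi> i (fst (v t) $ i) * (fst (v t) $ i - fst (snd (snd (snd (v t)))) $ i)) (at t within S)"
      using d(3) by (simp add: closed_loop_field_def case_prod_beta)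
    fix j
    show "((\<lambda>s. snd (snd (snd (snd (v s)))) $ i $ j) has_real_derivative
        - \<delta> i j * ((\<Sum>l\<in>UNIV. a i l * (snd (snd (snd (snd (v t)))) $ i $ j - snd (snd (snd (snd (v t)))) $ l $ j))
         + a i j * (snd (snd (snd (snd (v t)))) $ i $ j - fst (snd (snd (snd (v t)))) $ j))) (at t within S)"
      using d(5) by (simp add: closed_loop_field_def case_prod_beta)
  qed
qed

lemma norm_vec_le_sum: "norm (v :: 'a::real_normed_vector^'n::finite) \<le> (\<Sum>i\<in>UNIV. norm (v $ i))"
  unfolding norm_vec_def by (rule L2_set_le_sum) simp

text \<open>
  The decay estimate \<open>y\<close> for the seeking subsystem enters as a hypothesis and supplies the disturbance
  bound for every player.  The constant works for all solutions with the given initial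
  values on all intervals \<open>{0..T}\<close>, which is what the continuation argument requires.
\<close>

lemma loop_a_priori_bound:
  fixes b \<theta> :: "'n::finite \<Rightarrow> real"
  assumes b: "\<And>i. b i \<noteq> 0" and c: "c > 0"
    and y: "\<And>T x k h y z t. loop_solution_on {0..T} p b \<theta> \<phi> a \<delta> x k h y z \<Longrightarrow> y 0 = y0 \<Longrightarrow> z 0 = z0 \<Longrightarrow>
        t \<in> {0..T} \<Longrightarrow> norm (y t - xs) \<le> W * exp (- (c * t)) \<and>
          norm (z t - (\<chi> i. y t)) \<le> W * exp (- (c * t)) \<and> (\<forall>i. \<bar>p i (z t $ i)\<bar> \<le> W * exp (- (c * t)))"
  obtains B where "\<And>T x k h y z t. loop_solution_on {0..T} p b \<theta> \<phi> a \<delta> x k h y z \<Longrightarrow>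
      x 0 = x0 \<Longrightarrow> k 0 = k0 \<Longrightarrow> h 0 = h0 \<Longrightarrow> y 0 = y0 \<Longrightarrow> z 0 = z0 \<Longrightarrow> t \<in> {0..T} \<Longrightarrow>
      norm (x t, k t, h t, y t, z t) \<le> B"
proof -
  have "\<exists>B. \<forall>T x k h y y' t.
      player_solution_on {0..T} (b i) (\<theta> i) (\<phi> i) x k h y y' \<longrightarrow>
      (\<forall>t\<in>{0..T}. \<bar>y' t\<bar> \<le> W * exp (- (c * t))) \<longrightarrow>
      x 0 = x0 $ i \<longrightarrow> k 0 = k0 $ i \<longrightarrow> h 0 = h0 $ i \<longrightarrow> y 0 = y0 $ i \<longrightarrow> t \<in> {0..T} \<longrightarrow>
      \<bar>x t - y t\<bar> \<le> B \<and> \<bar>k t\<bar> \<le> B \<and> \<bar>h t\<bar> \<le> B" for i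
  proof (rule player_a_priori_bound[OF b c, of i "\<theta> i" "\<phi> i" W "x0 $ i" "k0 $ i" "h0 $ i" "y0 $ i"], goal_cases)
    case (1 B)
    then show ?case by (intro exI[of _ B] allI impI) blast
  qed
  then obtain B where B: "\<And>i T x k h y y' t.
      player_solution_on {0..T} (b i) (\<theta> i) (\<phi> i) x k h y y' \<Longrightarrow>
      (\<forall>t\<in>{0..T}. \<bar>y' t\<bar> \<le> W * exp (- (c * t))) \<Longrightarrow>
      x 0 = x0 $ i \<Longrightarrow> k 0 = k0 $ i \<Longrightarrow> h 0 = h0 $ i \<Longrightarrow> y 0 = y0 $ i \<Longrightarrow> t \<in> {0..T} \<Longrightarrow>
      \<bar>x t - y t\<bar> \<le> B i \<and> \<bar>k t\<bar> \<le> B i \<and> \<bar>h t\<bar> \<le> B i"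
    by metis
  define Y where "Y = W + norm xs"
  define S where "S = (\<Sum>i\<in>UNIV. B i)"
  have "norm (x t, k t, h t, y t, z t) \<le> (S + Y) + (S + (S + (Y + (W + (\<Sum>i\<in>(UNIV :: 'n set). Y)))))"
    if sol: "loop_solution_on {0..T} p b \<theta> \<phi> a \<delta> x k h y z"
      and init: "x 0 = x0" "k 0 = k0" "h 0 = h0" "y 0 = y0" "z 0 = z0" and t: "t \<in> {0..T}"
    for T x k h y z t
  proof -
    note est = y[OF sol init(4,5)]
    have W: "W * exp (- (c * t)) \<le> W"
    proof -
      have "0 \<le> W * exp (- (c * t))" using est[OF t] norm_ge_zero order_trans by blast
      then have "W \<ge> 0" by (simp add: zero_le_mult_iff)
      moreover have "exp (- (c * t)) \<le> 1" using c t by simp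
      ultimately show ?thesis by (rule mult_left_le[rotated])
    qed
    have yt: "norm (y t) \<le> Y"
      using est[OF t] W norm_triangle_sub[of "y t" xs] unfolding Y_def by linarith
    have "norm ((\<chi> i. y t) :: real^'n^'n) \<le> (\<Sum>i\<in>(UNIV :: 'n set). Y)"
      by (rule order_trans[OF norm_vec_le_sum]) (simp add: yt mult_left_mono)
    then have zt: "norm (z t) \<le> W + (\<Sum>i\<in>(UNIV :: 'n set). Y)"
      using est[OF t] W norm_triangle_sub[of "z t" "\<chi> i. y t"] by linarith
    have comp: "\<bar>x t $ i - y t $ i\<bar> \<le> B i \<and> \<bar>k t $ i\<bar> \<le> B i \<and> \<bar>h t $ i\<bar> \<le> B i" for i
    proof (rule B[of T i "\<lambda>s. x s $ i" "\<lambda>s. k s $ i" "\<lambda>s. h s $ i" "\<lambda>s. y s $ i" "\<lambda>s. - p i (z s $ i)"])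
      show "player_solution_on {0..T} (b i) (\<theta> i) (\<phi> i) (\<lambda>s. x s $ i) (\<lambda>s. k s $ i) (\<lambda>s. h s $ i)
            (\<lambda>s. y s $ i) (\<lambda>s. - p i (z s $ i))"
        using sol by (simp add: loop_solution_on_def)
      show "\<forall>t\<in>{0..T}. \<bar>- p i (z t $ i)\<bar> \<le> W * exp (- (c * t))"
        using est by simp
    qed (use init t in auto)
    have "norm (x t - y t) \<le> S" "norm (k t) \<le> S" "norm (h t) \<le> S"
      unfolding S_def using comp by (auto intro!: order_trans[OF norm_vec_le_sum] sum_mono)
    moreover have "norm (x t) \<le> norm (x t - y t) + norm (y t)"
      using norm_triangle_sub[of "x t" "y t"] by linarith
    moreover have "norm (x t, k t, h t, y t, z t)
        \<le> norm (x t) + (norm (k t) + (norm (h t) + (norm (y t) + norm (z t))))"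
      by (intro order_trans[OF norm_Pair_le] add_left_mono order_refl)
    ultimately show ?thesis using yt zt by linarith
  qed
  then show thesis by (rule that)
qed

theorem theorem1:
  fixes f :: "'n::finite \<Rightarrow> real^'n \<Rightarrow> real"
    and b \<theta> l :: "'n \<Rightarrow> real"
    and \<phi> :: "'n \<Rightarrow> real \<Rightarrow> real"
    and E :: "('n \<times> 'n) set"
    and a \<delta>b :: "'n \<Rightarrow> 'n \<Rightarrow> real"
    and m :: real
  assumes players: "CARD('n) \<ge> 2"
    and b_nonzero: "\<And>i. b i \<noteq> 0"
    and phi_smooth: "\<And>i. \<phi> i C1_differentiable_on UNIV"
    and f_smooth: "\<And>i. C1_function (f i)"
    and f_lipschitz: "\<And>i. (l i)-lipschitz_on UNIV (partial_deriv i (f i))"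
    and m_pos: "m > 0"
    and strongly_monotone: "\<And>x z. (x - z) \<bullet> (pseudogradient f x - pseudogradient f z)
                                   \<ge> m * (norm (x - z))\<^sup>2"
    and adjacency: "adjacency_matrix E a"
    and undirected: "undirected_graph E a"
    and connected: "connected_graph E"
    and phi_bounded: "\<And>i S. bounded S \<Longrightarrow> bounded (\<phi> i ` S) \<and> bounded (deriv (\<phi> i) ` S)"
    and db_pos: "\<And>i j. \<delta>b i j > 0"
  shows "\<exists>xs. nash_equilibrium f xs \<and> (\<forall>w. nash_equilibrium f w \<longrightarrow> w = xs) \<and>
    (\<exists>\<delta>s>0. \<forall>\<delta>>\<delta>s. \<forall>x0 k0 \<theta>h0 y0 z0.
      (\<exists>x k \<theta>h y z.
         closed_loop_solution f b \<theta> \<phi> a (\<lambda>i j. \<delta> * \<delta>b i j) x k \<theta>h y z \<and>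
         x 0 = x0 \<and> k 0 = k0 \<and> \<theta>h 0 = \<theta>h0 \<and> y 0 = y0 \<and> z 0 = z0) \<and>
      (\<forall>x k \<theta>h y z.
         closed_loop_solution f b \<theta> \<phi> a (\<lambda>i j. \<delta> * \<delta>b i j) x k \<theta>h y z \<and>
         x 0 = x0 \<and> k 0 = k0 \<and> \<theta>h 0 = \<theta>h0 \<and> y 0 = y0 \<and> z 0 = z0 \<longrightarrow>
         ((\<lambda>t. norm (x t - xs)) \<longlongrightarrow> 0) at_top \<and>
         (\<forall>i. bounded ((\<lambda>t. k t $ i) ` {0..}) \<and> bounded ((\<lambda>t. \<theta>h t $ i) ` {0..}))))"
proof -
  define p where "p i = partial_deriv i (f i)" for i
  have P: "pseudogradient f x = (\<chi> i. p i x)" for x by (simp add: pseudogradient_def p_def)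
  have p_lip: "(l i)-lipschitz_on UNIV (p i)" for i unfolding p_def by (rule f_lipschitz)
  have mono0: "(x - z) \<bullet> (pseudogradient f x - pseudogradient f z) \<ge> 0" for x z
  proof -
    have "0 \<le> m * (norm (x - z))\<^sup>2" using m_pos by simp
    then show ?thesis using strongly_monotone by (rule order_trans)
  qed
  have nash: "nash_equilibrium f x \<longleftrightarrow> pseudogradient f x = 0" for x
    by (rule nash_equilibrium_iff_pseudogradient_zero[OF f_smooth mono0])
  have "(\<Sum>i\<in>UNIV. l i)-lipschitz_on UNIV (pseudogradient f)"
    unfolding P[abs_def] by (rule lipschitz_on_vec_lambda[OF p_lip])
  then have "\<exists>!x. pseudogradient f x = 0"
    by (rule strongly_monotone_unique_zero[OF m_pos strongly_monotone])
  then obtain xs where xs: "pseudogradient f xs = 0" and unique: "\<And>w. pseudogradient f w = 0 \<Longrightarrow> w = xs"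
    by blast
  have zero: "p i xs = 0" for i using xs by (simp add: P vec_eq_iff)
  obtain \<mu> where \<mu>: "\<mu> > 0" "\<And>e. consensus_form a e \<ge> \<mu> * (norm e)\<^sup>2"
    by (rule consensus_form_coercive[OF consensus_form_pos[OF players adjacency undirected connected]])
       (assumption, rule that)
  obtain \<delta>s c A where \<delta>s: "\<delta>s > 0" and c: "c > 0"
    and conv: "\<And>\<delta> T y z t. \<delta> > \<delta>s \<Longrightarrow> seeking_solution_on {0..T} p a (\<lambda>i j. \<delta> * \<delta>b i j) y z \<Longrightarrow> t \<in> {0..T} \<Longrightarrow>
      norm (y t - xs) \<le> A * sqrt (seeking_energy \<delta>b xs (y 0) (z 0)) * exp (- (c * t)) \<and>
      norm (z t - (\<chi> i. y t)) \<le> A * sqrt (seeking_energy \<delta>b xs (y 0) (z 0)) * exp (- (c * t)) \<and>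
      (\<forall>i. \<bar>p i (z t $ i)\<bar> \<le> A * sqrt (seeking_energy \<delta>b xs (y 0) (z 0)) * exp (- (c * t)))"
    by (rule seeking_exponential_convergence[where p = p and l = l, OF p_lip zero m_pos strongly_monotone[unfolded P] db_pos \<mu>])
       (rule that)
  let ?sol = "\<lambda>\<delta> x k h y z. closed_loop_solution f b \<theta> \<phi> a (\<lambda>i j. \<delta> * \<delta>b i j) x k h y z"
  have sol_iff: "?sol \<delta> x k h y z \<longleftrightarrow> loop_solution_on {0..} p b \<theta> \<phi> a (\<lambda>i j. \<delta> * \<delta>b i j) x k h y z"
    for \<delta> x k h y z
    unfolding closed_loop_solution_iff_loop_solution_on p_def[abs_def] ..
  have existence: "\<exists>x k h y z. ?sol \<delta> x k h y z \<and> x 0 = x0 \<and> k 0 = k0 \<and> h 0 = h0 \<and> y 0 = y0 \<and> z 0 = z0"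
    if \<delta>: "\<delta> > \<delta>s" for \<delta> x0 k0 h0 y0 z0
  proof -
    let ?F = "closed_loop_field p b \<theta> \<phi> a (\<lambda>i j. \<delta> * \<delta>b i j)"
    let ?W = "A * sqrt (seeking_energy \<delta>b xs y0 z0)"
    have est: "norm (y t - xs) \<le> ?W * exp (- (c * t)) \<and> norm (z t - (\<chi> i. y t)) \<le> ?W * exp (- (c * t)) \<and>
        (\<forall>i. \<bar>p i (z t $ i)\<bar> \<le> ?W * exp (- (c * t)))"
      if "loop_solution_on {0..T} p b \<theta> \<phi> a (\<lambda>i j. \<delta> * \<delta>b i j) x k h y z" "y 0 = y0" "z 0 = z0" "t \<in> {0..T}"
      for T x k h y z t
      using conv[OF \<delta>, of T y z t] that by (simp add: loop_solution_on_def)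
    obtain B where B: "\<And>T x k h y z t. loop_solution_on {0..T} p b \<theta> \<phi> a (\<lambda>i j. \<delta> * \<delta>b i j) x k h y z \<Longrightarrow>
      x 0 = x0 \<Longrightarrow> k 0 = k0 \<Longrightarrow> h 0 = h0 \<Longrightarrow> y 0 = y0 \<Longrightarrow> z 0 = z0 \<Longrightarrow> t \<in> {0..T} \<Longrightarrow>
      norm (x t, k t, h t, y t, z t) \<le> B"
      by (rule loop_a_priori_bound[where b = b and W = ?W and p = p and a = a and \<theta> = \<theta> and \<phi> = \<phi> and xs = xs
            and \<delta> = "\<lambda>i j. \<delta> * \<delta>b i j" and ?x0.0 = x0 and ?k0.0 = k0 and ?h0.0 = h0 and ?y0.0 = y0 and ?z0.0 = z0,
            OF b_nonzero c]) ((rule est; assumption), rule that)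
    have bound: "norm (v t) \<le> B"
      if v0: "v 0 = (x0, k0, h0, y0, z0)" and t: "t \<in> {0..T}"
        and v: "\<And>t. t \<in> {0..T} \<Longrightarrow> (v has_vector_derivative ?F (v t)) (at t within {0..T})" for v T t
    proof -
      have "loop_solution_on {0..T} p b \<theta> \<phi> a (\<lambda>i j. \<delta> * \<delta>b i j) (\<lambda>t. fst (v t)) (\<lambda>t. fst (snd (v t)))
         (\<lambda>t. fst (snd (snd (v t)))) (\<lambda>t. fst (snd (snd (snd (v t))))) (\<lambda>t. snd (snd (snd (snd (v t)))))"
        by (rule loop_solution_on_of_field) (rule v)
      from B[OF this _ _ _ _ _ t] show ?thesis by (simp add: v0)
    qed
    have lip: "\<exists>L. L-lipschitz_on (cball 0 R) ?F" for R
    proof -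
      have "lipschitz_on_balls ?F" by (rule lipschitz_on_balls_closed_loop_field[where l = l]) (rule phi_smooth p_lip)+
      then show ?thesis unfolding lipschitz_on_balls_def by blast
    qed
    obtain v where v0: "v 0 = (x0, k0, h0, y0, z0)"
      and v: "\<And>t. t \<ge> 0 \<Longrightarrow> (v has_vector_derivative ?F (v t)) (at t within {0..})"
      by (rule global_solution_of_a_priori_bound[where F = ?F and ?v0.0 = "(x0, k0, h0, y0, z0)" and B = B, OF lip])
         ((rule bound; assumption), rule that)
    have "loop_solution_on {0..} p b \<theta> \<phi> a (\<lambda>i j. \<delta> * \<delta>b i j) (\<lambda>t. fst (v t)) (\<lambda>t. fst (snd (v t)))
       (\<lambda>t. fst (snd (snd (v t)))) (\<lambda>t. fst (snd (snd (snd (v t))))) (\<lambda>t. snd (snd (snd (snd (v t)))))"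
      by (rule loop_solution_on_of_field) (use v in simp)
    then show ?thesis
      unfolding sol_iff by (intro exI conjI, assumption) (simp_all add: v0)
  qed
  have convergence: "((\<lambda>t. norm (x t - xs)) \<longlongrightarrow> 0) at_top \<and>
      (\<forall>i. bounded ((\<lambda>t. k t $ i) ` {0..}) \<and> bounded ((\<lambda>t. h t $ i) ` {0..}))"
    if \<delta>: "\<delta> > \<delta>s" and sol: "?sol \<delta> x k h y z" for \<delta> x k h y z
  proof -
    define W where "W = A * sqrt (seeking_energy \<delta>b xs (y 0) (z 0))"
    have loop: "loop_solution_on {0..} p b \<theta> \<phi> a (\<lambda>i j. \<delta> * \<delta>b i j) x k h y z"
      using sol sol_iff by blast
    have "seeking_solution_on {0..t} p a (\<lambda>i j. \<delta> * \<delta>b i j) y z" for t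
      using loop_solution_on_subset[OF loop, of "{0..t}"] by (auto simp: loop_solution_on_def)
    then have y: "norm (y t - xs) \<le> W * exp (- (c * t))"
      and p: "\<bar>p i (z t $ i)\<bar> \<le> W * exp (- (c * t))" if "t \<ge> 0" for t i
      using conv[OF \<delta>, of t y z t] that by (auto simp: W_def)
    have "filterlim (\<lambda>t. c * t) at_top at_top"
      by (rule filterlim_tendsto_pos_mult_at_top[OF tendsto_const c filterlim_ident])
    then have "((\<lambda>t. exp (- (c * t))) \<longlongrightarrow> 0) at_top"
      unfolding filterlim_uminus_at_top by (rule filterlim_compose[OF exp_at_bot])
    then have "((\<lambda>t. W * exp (- (c * t))) \<longlongrightarrow> 0) at_top"
      by (rule tendsto_mult_right_zero)
    then have y_lim: "((\<lambda>t. y t - xs) \<longlongrightarrow> 0) at_top"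
      by (rule Lim_null_comparison[rotated]) (intro eventually_at_top_linorderI[of 0] y)
    have y_bound: "\<bar>y t $ i\<bar> \<le> W + norm xs" if t: "t \<ge> 0" for t i
    proof -
      have "0 \<le> W * exp (- (c * t))" using y[OF t] norm_ge_zero order_trans by blast
      then have "W \<ge> 0" by (simp add: zero_le_mult_iff)
      moreover have "exp (- (c * t)) \<le> 1" using c t by simp
      ultimately have "W * exp (- (c * t)) \<le> W" by (rule mult_left_le[rotated])
      then show ?thesis
        using component_le_norm_cart[of "y t" i] norm_triangle_sub[of "y t" xs] y[OF t] by linarith
    qed
    have player: "player_solution_on {0..} (b i) (\<theta> i) (\<phi> i) (\<lambda>s. x s $ i) (\<lambda>s. k s $ i) (\<lambda>s. h s $ i)
            (\<lambda>s. y s $ i) (\<lambda>s. - p i (z s $ i))" for i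
      using loop by (simp add: loop_solution_on_def)
    have p': "\<bar>- p i (z t $ i)\<bar> \<le> W * exp (- (c * t))" if "t \<ge> 0" for t i using p[OF that] by simp
    have phi_b: "bounded (\<phi> i ` S)" if "bounded S" for i S using phi_bounded[OF that] by blast
    have track: "((\<lambda>t. x t $ i - y t $ i) \<longlongrightarrow> 0) at_top"
      "bounded ((\<lambda>t. k t $ i) ` {0..})" "bounded ((\<lambda>t. h t $ i) ` {0..})" for i
      by (rule player_convergence[OF b_nonzero c player[of i]]; (rule p' y_bound phi_b; assumption))+
    have "((\<lambda>t. x t - y t) \<longlongrightarrow> 0) at_top"
      by (rule vec_tendstoI) (use track(1) in simp)
    from tendsto_add[OF this y_lim] have "((\<lambda>t. x t - xs) \<longlongrightarrow> 0) at_top" by simp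
    then show ?thesis using track(2,3) by (auto intro: tendsto_norm_zero)
  qed
  show ?thesis
  proof (rule exI[of _ xs], intro conjI)
    show "nash_equilibrium f xs" using nash xs by blast
    show "\<forall>w. nash_equilibrium f w \<longrightarrow> w = xs" using nash unique by blast
  qed (rule exI[of _ \<delta>s], rule conjI, rule \<delta>s, intro allI impI, rule conjI, erule existence,
       intro allI impI, elim conjE, rule convergence, assumption+)
qed

end
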